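(* Let $G$ be a structured bilinear (MIMO) system given by $\mathcal{C},\mathcal{K},\mathcal{N},\mathcal{B}$, with subsystem transfer functions $G_k$, and let $\widehat G$, with subsystem transfer functions $\widehat G_k$, be the reduced-order bilinear system constructed by projection with $W,V\in\mathbb{C}^{n\times r}$. Let $\sigma_1,\ldots,\sigma_k\in\mathbb{C}$ and $\varsigma_1,\ldots,\varsigma_\theta\in\mathbb{C}$ be sets of interpolation points at which the matrix functions $\mathcal{C}(s)$, $\mathcal{K}(s)^{-1}$, $\mathcal{N}(s)$, $\mathcal{B}(s)$ are defined and $\widehat{\mathcal{K}}(s)$ is full-rank. Then the following statements hold. (a) If $V$ is constructed as \[ V_1=\mathcal{K}(\sigma_1)^{-1}\mathcal{B}(\sigma_1),\qquad V_j=\mathcal{K}(\sigma_j)^{-1}\mathcal{N}(\sigma_{j-1})(I_m\otimes V_{j-1}),\quad 2\le j\le k,\qquad \operatorname{span}(V)\supseteq\operatorname{span}([V_1,\ldots,V_k]), \] then \[ G_1(\sigma_1)=\widehat G_1(\sigma_1),\quad G_2(\sigma_1,\sigma_2)=\widehat G_2(\sigma_1,\sigma_2),\quad\ldots,\quad G_k(\sigma_1,\ldots,\sigma_k)=\widehat G_k(\sigma_1,\ldots,\sigma_k). \] (b) If $W$ is constructed as \[ W_1=\mathcal{K}(\varsigma_\theta)^{-\mathsf H}\mathcal{C}(\varsigma_\theta)^{\mathsf H},\qquad W_i=\mathcal{K}(\varsigma_{\theta-i+1})^{-\mathsf H}\widetilde{\mathcal{N}}(\varsigma_{\theta-i+1})^{\mathsf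 H}(I_m\otimes W_{i-1}),\quad 2\le i\le\theta,\qquad \operatorname{span}(W)\supseteq\operatorname{span}([W_1,\ldots,W_\theta]), \] then \[ G_1(\varsigma_\theta)=\widehat G_1(\varsigma_\theta),\quad G_2(\varsigma_{\theta-1},\varsigma_\theta)=\widehat G_2(\varsigma_{\theta-1},\varsigma_\theta),\quad\ldots,\quad G_\theta(\varsigma_1,\ldots,\varsigma_\theta)=\widehat G_\theta(\varsigma_1,\ldots,\varsigma_\theta). \] (c) If $V$ is constructed as in part (a) and $W$ as in part (b), then, additionally to the results in (a) and (b), the interpolation conditions \[ G_{q+\eta}(\sigma_1,\ldots,\sigma_q,\varsigma_{\theta-\eta+1},\ldots,\varsigma_\theta)=\widehat G_{q+\eta}(\sigma_1,\ldots,\sigma_q,\varsigma_{\theta-\eta+1},\ldots,\varsigma_\theta) \] hold for $1\le q\le k$ and $1\le\eta\le\theta$.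
   Context: A structured bilinear MIMO (multi-input multi-output) system $G$ is described by matrix-valued functions of a complex variable $\mathcal{C}\colon\mathbb{C}\to\mathbb{C}^{p\times n}$, $\mathcal{K}\colon\mathbb{C}\to\mathbb{C}^{n\times n}$, $\mathcal{B}\colon\mathbb{C}\to\mathbb{C}^{n\times m}$, $\mathcal{N}_j\colon\mathbb{C}\to\mathbb{C}^{n\times n}$, $j=1,\ldots,m$ (which may fail to be defined, or $\mathcal{K}$ may fail to be invertible, at some points). Write \[ \mathcal{N}(s)=\begin{bmatrix}\mathcal{N}_1(s)&\ldots&\mathcal{N}_m(s)\end{bmatrix}\in\mathbb{C}^{n\times nm},\qquad \widetilde{\mathcal{N}}(s)=\begin{bmatrix}\mathcal{N}_1(s)\\ \vdots\\ \mathcal{N}_m(s)\end{bmatrix}\in\mathbb{C}^{nm\times n}. \] The regular subsystem transfer functions of $G$ are \[ G_k(s_1,\ldots,s_k)=\mathcal{C}(s_k)\mathcal{K}(s_k)^{-1}\Big(\prod_{j=1}^{k-1}\big(I_{m^{j-1}}\otimes\mathcal{N}(s_{k-j})\big)\big(I_{m^j}\otimes\mathcal{K}(s_{k-j})^{-1}\big)\Big)\big(I_{m^{k-1}}\otimes\mathcal{B}(s_1)\big),\qquad k\ge1, \] with $I_d$ the $d\times d$ identity and $\otimes$ the Kronecker product. Products $\prod_{j=1}^{l}A_j$ of matrices are ordered $A_1A_2\cdots A_l$; empty products are identities. Given model reduction bases (truncation matrices) $W,V\in\mathbb{C}^{n\times r}$, the reduced-order system $\widehat G$ is given by \[ \widehat{\mathcal{C}}(s)=\mathcal{C}(s)V,\quad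 \widehat{\mathcal{K}}(s)=W^{\mathsf H}\mathcal{K}(s)V,\quad \widehat{\mathcal{B}}(s)=W^{\mathsf H}\mathcal{B}(s),\quad \widehat{\mathcal{N}}_j(s)=W^{\mathsf H}\mathcal{N}_j(s)V,\ j=1,\ldots,m, \] $\widehat{\mathcal{N}}=[\widehat{\mathcal{N}}_1\ \ldots\ \widehat{\mathcal{N}}_m]$, and its transfer functions $\widehat G_k$ are defined by the same formula with hatted quantities. Here $^{\mathsf H}$ is the conjugate transpose, $^{-\mathsf H}$ the conjugate transpose of the inverse, and $\operatorname{span}$ of a matrix is its column space. *)

theory Defs
  imports
    "Jordan_Normal_Form.Schur_Decomposition"
    "Jordan_Normal_Form.Gauss_Jordan_Elimination"
    "Jordan_Normal_Form.DL_Rank"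
begin

definition hcat :: "nat \<Rightarrow> 'a mat list \<Rightarrow> 'a mat" where
  "hcat nr As = mat_of_cols nr (concat (map cols As))"

definition vcat :: "nat \<Rightarrow> 'a mat list \<Rightarrow> 'a mat" where
  "vcat nc As = mat_of_rows nc (concat (map rows As))"

definition kronecker :: "'a :: times mat \<Rightarrow> 'a mat \<Rightarrow> 'a mat" (infixl "\<otimes>\<^sub>K" 72) where
  "A \<otimes>\<^sub>K B = mat (dim_row A * dim_row B) (dim_col A * dim_col B)
     (\<lambda>(i, j). A $$ (i div dim_row B, j div dim_col B) * B $$ (i mod dim_row B, j mod dim_col B))"

text \<open>The ordered product \<open>A 1 * A 2 * \<dots> * A l\<close>, where \<open>A 1\<close> has \<open>d\<close> rows; the empty product is
  the identity of size \<open>d\<close>.\<close>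

definition mat_prod :: "nat \<Rightarrow> (nat \<Rightarrow> 'a :: semiring_1 mat) \<Rightarrow> nat \<Rightarrow> 'a mat" where
  "mat_prod d A l = foldl (*) (1\<^sub>m d) (map A [1..<Suc l])"

text \<open>The matrix functions are partial: the value \<open>None\<close> means that the function is not defined at
  the given point. The family \<open>N_fun\<close> is used at the indices \<open>1, \<dots>, inputs\<close>.\<close>

record bilinear_system =
  states :: nat
  inputs :: nat
  outputs :: nat
  C_fun :: "complex \<rightharpoonup> complex mat"
  K_fun :: "complex \<rightharpoonup> complex mat"
  B_fun :: "complex \<rightharpoonup> complex mat"
  N_fun :: "nat \<Rightarrow> complex \<rightharpoonup> complex mat"

definition structured_bilinear_system :: "bilinear_system \<Rightarrow> bool" where
  "structured_bilinear_system G \<longleftrightarrow>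
     ran (C_fun G) \<subseteq> carrier_mat (outputs G) (states G) \<and>
     ran (K_fun G) \<subseteq> carrier_mat (states G) (states G) \<and>
     ran (B_fun G) \<subseteq> carrier_mat (states G) (inputs G) \<and>
     (\<forall>j \<in> {1..inputs G}. ran (N_fun G j) \<subseteq> carrier_mat (states G) (states G))"

definition K_inv_fun :: "bilinear_system \<Rightarrow> complex \<rightharpoonup> complex mat" where
  "K_inv_fun G s = Option.bind (K_fun G s) mat_inverse"

definition defined_at :: "bilinear_system \<Rightarrow> complex \<Rightarrow> bool" where
  "defined_at G s \<longleftrightarrow> s \<in> dom (C_fun G) \<and> s \<in> dom (K_inv_fun G) \<and> s \<in> dom (B_fun G) \<and>
     (\<forall>j \<in> {1..inputs G}. s \<in> dom (N_fun G j))"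

text \<open>Values of the matrix functions, meaningful only at points where these are defined.\<close>

definition C_at :: "bilinear_system \<Rightarrow> complex \<Rightarrow> complex mat" where
  "C_at G s = the (C_fun G s)"

definition K_at :: "bilinear_system \<Rightarrow> complex \<Rightarrow> complex mat" where
  "K_at G s = the (K_fun G s)"

definition K_inv_at :: "bilinear_system \<Rightarrow> complex \<Rightarrow> complex mat" where
  "K_inv_at G s = the (K_inv_fun G s)"

definition B_at :: "bilinear_system \<Rightarrow> complex \<Rightarrow> complex mat" where
  "B_at G s = the (B_fun G s)"

definition N_row_at :: "bilinear_system \<Rightarrow> complex \<Rightarrow> complex mat" where
  "N_row_at G s = hcat (states G) (map (\<lambda>j. the (N_fun G j s)) [1..<Suc (inputs G)])"

definition N_col_at :: "bilinear_system \<Rightarrow> complex \<Rightarrow> complex mat" where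
  "N_col_at G s = vcat (states G) (map (\<lambda>j. the (N_fun G j s)) [1..<Suc (inputs G)])"

text \<open>For \<open>ss = [s\<^sub>1, \<dots>, s\<^sub>k]\<close> with \<open>k \<ge> 1\<close>, the regular transfer function of the \<open>k\<close>-th subsystem
  at \<open>(s\<^sub>1, \<dots>, s\<^sub>k)\<close>. The local \<open>s\<close> restores the one-based numbering of the arguments.\<close>

definition transfer :: "bilinear_system \<Rightarrow> complex list \<Rightarrow> complex mat" where
  "transfer G ss = (let k = length ss; s = (\<lambda>i. ss ! (i - 1)); m = inputs G in
     C_at G (s k) * K_inv_at G (s k) *
     mat_prod (states G)
       (\<lambda>j. (1\<^sub>m (m ^ (j - 1)) \<otimes>\<^sub>K N_row_at G (s (k - j))) *
            (1\<^sub>m (m ^ j) \<otimes>\<^sub>K K_inv_at G (s (k - j)))) (k - 1) *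
     (1\<^sub>m (m ^ (k - 1)) \<otimes>\<^sub>K B_at G (s 1)))"

definition reduced_system :: "complex mat \<Rightarrow> complex mat \<Rightarrow> bilinear_system \<Rightarrow> bilinear_system" where
  "reduced_system W V G =
     \<lparr>states = dim_col V, inputs = inputs G, outputs = outputs G,
      C_fun = (\<lambda>s. map_option (\<lambda>A. A * V) (C_fun G s)),
      K_fun = (\<lambda>s. map_option (\<lambda>A. mat_adjoint W * A * V) (K_fun G s)),
      B_fun = (\<lambda>s. map_option (\<lambda>A. mat_adjoint W * A) (B_fun G s)),
      N_fun = (\<lambda>j s. map_option (\<lambda>A. mat_adjoint W * A * V) (N_fun G j s))\<rparr>"

text \<open>The blocks below are numbered from one and left unspecified at index zero.\<close>

fun V_block :: "bilinear_system \<Rightarrow> (nat \<Rightarrow> complex) \<Rightarrow> nat \<Rightarrow> complex mat" where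
  "V_block G \<sigma> (Suc 0) = K_inv_at G (\<sigma> 1) * B_at G (\<sigma> 1)"
| "V_block G \<sigma> (Suc (Suc j)) =
     K_inv_at G (\<sigma> (Suc (Suc j))) * N_row_at G (\<sigma> (Suc j)) *
     (1\<^sub>m (inputs G) \<otimes>\<^sub>K V_block G \<sigma> (Suc j))"

fun W_block :: "bilinear_system \<Rightarrow> nat \<Rightarrow> (nat \<Rightarrow> complex) \<Rightarrow> nat \<Rightarrow> complex mat" where
  "W_block G \<theta> \<tau> (Suc 0) = mat_adjoint (K_inv_at G (\<tau> \<theta>)) * mat_adjoint (C_at G (\<tau> \<theta>))"
| "W_block G \<theta> \<tau> (Suc (Suc i)) =
     mat_adjoint (K_inv_at G (\<tau> (\<theta> - Suc (Suc i) + 1))) *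
     mat_adjoint (N_col_at G (\<tau> (\<theta> - Suc (Suc i) + 1))) *
     (1\<^sub>m (inputs G) \<otimes>\<^sub>K W_block G \<theta> \<tau> (Suc i))"

abbreviation column_space :: "nat \<Rightarrow> complex mat \<Rightarrow> complex vec set" where
  "column_space n \<equiv> vec_space.col_space n"

definition V_basis :: "bilinear_system \<Rightarrow> nat \<Rightarrow> (nat \<Rightarrow> complex) \<Rightarrow> complex mat \<Rightarrow> bool" where
  "V_basis G k \<sigma> V \<longleftrightarrow>
     column_space (states G) (hcat (states G) (map (V_block G \<sigma>) [1..<Suc k]))
       \<subseteq> column_space (states G) V"

definition W_basis :: "bilinear_system \<Rightarrow> nat \<Rightarrow> (nat \<Rightarrow> complex) \<Rightarrow> complex mat \<Rightarrow> bool" where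
  "W_basis G \<theta> \<tau> W \<longleftrightarrow>
     column_space (states G) (hcat (states G) (map (W_block G \<theta> \<tau>) [1..<Suc \<theta>]))
       \<subseteq> column_space (states G) W"

end

theory Submission
  imports Defs
begin

text \<open>By the mixed-product rule, \<open>G\<^sub>k(s\<^sub>1, \<dots>, s\<^sub>k) = C(s\<^sub>k) V\<^sub>k\<close>, where \<open>K(s\<^sub>j) V\<^sub>j = R\<^sub>j\<close> with
  \<open>R\<^sub>1 = B(s\<^sub>1)\<close> and \<open>R\<^sub>j = N(s\<^bsub>j-1\<^esub>) (I \<otimes> V\<^bsub>j-1\<^esub>)\<close>. If \<open>V\<^sub>j = V X\<close>, then multiplying \<open>K V X = R\<^sub>j\<close>
  by \<open>W\<^sup>H\<close> shows that \<open>X\<close> solves the equation of the reduced block, inductively; this gives (a).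
  Dually, the rows \<open>U\<^sub>i = W\<^sub>i\<^sup>H\<close> are the reduced ones multiplied by \<open>W\<^sup>H\<close> from the right, while
  \<open>W\<^sup>H R\<^bsub>q+1\<^esub>\<close> is the reduced \<open>R\<^bsub>q+1\<^esub>\<close>. Hence \<open>U\<^sub>\<eta> R\<^bsub>q+1\<^esub>\<close> is the same for both systems. It contains the
  blocks of \<open>G\<^bsub>q+\<eta>\<^esub>\<close>, stacked instead of side by side, which gives (c), and (b) as the case
  \<open>q = 0\<close>.\<close>

subsection \<open>Sums over pairs and uniform concatenation\<close>

text \<open>Kronecker products and block matrices encode a pair of indices as quotient and
  remainder; this turns the sum over such an index in a matrix product into a double sum.\<close>

lemma sum_div_mod:
  fixes f :: "nat \<Rightarrow> nat \<Rightarrow> 'a :: comm_monoid_add"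
  shows "(\<Sum>k = 0..<a * b. f (k div b) (k mod b)) = (\<Sum>i = 0..<a. \<Sum>j = 0..<b. f i j)"
proof -
  have "(\<Sum>k = 0..<a * b. f (k div b) (k mod b)) = (\<Sum>(i, j) \<in> {0..<a} \<times> {0..<b}. f i j)"
  proof (rule sum.reindex_bij_witness[where j = "\<lambda>k. (k div b, k mod b)"
        and i = "\<lambda>(i, j). i * b + j"], goal_cases)
    case (1 k)
    then show ?case by simp
  next
    case (2 k)
    then show ?case by (cases "b = 0") (auto simp: less_mult_imp_div_less)
  next
    case (3 x)
    then show ?case by auto
  next
    case (4 x)
    obtain i j where x: "x = (i, j)" "i < a" "j < b" using 4 by auto
    have "i * b + j < Suc i * b" using x by simp
    also have "\<dots> \<le> a * b" using x by (intro mult_le_mono1) simp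
    finally show ?case using x by simp
  qed auto
  then show ?thesis by (simp add: sum.cartesian_product)
qed

text \<open>Past the first block, dropping that block lowers the quotient by one and keeps the
  remainder.\<close>

lemma nth_concat_uniform:
  assumes "\<And>xs. xs \<in> set xss \<Longrightarrow> length xs = n" and "i < length xss * n"
  shows "concat xss ! i = xss ! (i div n) ! (i mod n)"
  using assms
proof (induction xss arbitrary: i)
  case (Cons xs xss)
  show ?case
  proof (cases "i < n")
    case False
    have "concat xss ! (i - n) = xss ! ((i - n) div n) ! ((i - n) mod n)"
      using Cons.prems False by (intro Cons.IH) auto
    moreover have "n > 0" using Cons.prems(2) by (cases n) auto
    ultimately show ?thesis
      using False Cons.prems by (simp add: nth_append le_div_geq le_mod_geq)
  qed (use Cons.prems in \<open>simp add: nth_append\<close>)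
qed simp

lemma length_concat_uniform:
  assumes "\<And>xs. xs \<in> set xss \<Longrightarrow> length xs = n"
  shows "length (concat xss) = length xss * n"
  by (use assms in \<open>induction xss\<close>) (simp_all del: length_concat)

subsection \<open>Kronecker products\<close>

lemma kronecker_dim [simp]:
  "dim_row (A \<otimes>\<^sub>K B) = dim_row A * dim_row B" "dim_col (A \<otimes>\<^sub>K B) = dim_col A * dim_col B"
  by (simp_all add: kronecker_def)

lemma kronecker_carrier [intro]:
  "A \<in> carrier_mat a b \<Longrightarrow> B \<in> carrier_mat c d \<Longrightarrow> A \<otimes>\<^sub>K B \<in> carrier_mat (a * c) (b * d)"
  by (metis carrier_matD carrier_matI kronecker_dim)

lemma kronecker_index:
  "i < dim_row A * dim_row B \<Longrightarrow> j < dim_col A * dim_col B \<Longrightarrow>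
   (A \<otimes>\<^sub>K B) $$ (i, j) =
     A $$ (i div dim_row B, j div dim_col B) * B $$ (i mod dim_row B, j mod dim_col B)"
  by (simp add: kronecker_def)

lemma mod_less_of_less_mult: "(i :: nat) < a * b \<Longrightarrow> i mod b < b"
  by (cases "b = 0") auto

lemma mult_mat_index:
  fixes A :: "'a :: semiring_0 mat"
  assumes "A \<in> carrier_mat a b" and "B \<in> carrier_mat b c" and "i < a" and "j < c"
  shows "(A * B) $$ (i, j) = (\<Sum>k = 0..<b. A $$ (i, k) * B $$ (k, j))"
  using assms by (auto simp: scalar_prod_def intro!: sum.cong)

text \<open>The mixed-product rule. Commutativity moves the entry of \<open>C\<close> past that of
  \<open>B\<close>, and the double sum then splits into a product of two sums.\<close>

lemma kronecker_mult:
  fixes A :: "'a :: comm_semiring_0 mat"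
  assumes A: "A \<in> carrier_mat a b" and C: "C \<in> carrier_mat b c"
    and B: "B \<in> carrier_mat d e" and D: "D \<in> carrier_mat e f"
  shows "(A \<otimes>\<^sub>K B) * (C \<otimes>\<^sub>K D) = (A * C) \<otimes>\<^sub>K (B * D)"
proof (rule eq_matI, goal_cases)
  case (1 i j)
  then have i: "i < a * d" and j: "j < c * f" using assms by auto
  note div = less_mult_imp_div_less[OF i] less_mult_imp_div_less[OF j]
  note mod = mod_less_of_less_mult[OF i] mod_less_of_less_mult[OF j]
  have "((A \<otimes>\<^sub>K B) * (C \<otimes>\<^sub>K D)) $$ (i, j) =
      (\<Sum>k = 0..<b * e. (A \<otimes>\<^sub>K B) $$ (i, k) * (C \<otimes>\<^sub>K D) $$ (k, j))"
    by (rule mult_mat_index) (use assms i j in auto)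
  \<comment> \<open>The summand is written as an unreduced application to \<open>k div e\<close> and
    \<open>k mod e\<close>, the shape that \<open>sum_div_mod\<close> expects.\<close>
  also have "\<dots> = (\<Sum>k = 0..<b * e. (\<lambda>u v. (A $$ (i div d, u) * B $$ (i mod d, v)) *
      (C $$ (u, j div f) * D $$ (v, j mod f))) (k div e) (k mod e))"
    using assms i j by (intro sum.cong) (auto simp: kronecker_index)
  also have "\<dots> = (\<Sum>u = 0..<b. \<Sum>v = 0..<e. (A $$ (i div d, u) * B $$ (i mod d, v)) *
      (C $$ (u, j div f) * D $$ (v, j mod f)))"
    by (rule sum_div_mod)
  also have "\<dots> = (\<Sum>u = 0..<b. A $$ (i div d, u) * C $$ (u, j div f)) *
      (\<Sum>v = 0..<e. B $$ (i mod d, v) * D $$ (v, j mod f))"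
    by (simp add: sum_product mult_ac)
  also have "\<dots> = ((A * C) \<otimes>\<^sub>K (B * D)) $$ (i, j)"
    using assms i j div mod
    by (simp add: kronecker_index mult_mat_index[of A a b] mult_mat_index[of B d e]
        del: index_mult_mat(1))
  finally show ?case .
qed (use assms in auto)

text \<open>Both sides read an index as the same three digits in mixed radix, for rows
  \<open>i div c div b\<close>, \<open>i div c mod b\<close> and \<open>i mod c\<close>. The facts
  \<open>divmod\<close>, \<open>modmod\<close> and \<open>divdiv\<close> translate the digits of the
  right-hand side into these.\<close>

lemma kronecker_assoc:
  fixes A :: "'a :: semigroup_mult mat"
  shows "(A \<otimes>\<^sub>K B) \<otimes>\<^sub>K C = A \<otimes>\<^sub>K (B \<otimes>\<^sub>K C)"
proof (rule eq_matI, goal_cases)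
  case (1 i j)
  define a b c where "a = dim_row A" and "b = dim_row B" and "c = dim_row C"
  define a' b' c' where "a' = dim_col A" and "b' = dim_col B" and "c' = dim_col C"
  note defs = a_def b_def c_def a'_def b'_def c'_def
  have i: "i < a * b * c" "i < a * (b * c)" and j: "j < a' * b' * c'" "j < a' * (b' * c')"
    using 1 by (auto simp: defs mult.assoc)
  have pos: "c > 0" "c' > 0" using i j by (auto intro!: Nat.gr0I)
  have "i mod (c * b) div c = i div c mod b" "j mod (c' * b') div c' = j div c' mod b'"
    using pos by (simp_all add: mod_mult2_eq)
  then have divmod: "i mod (b * c) div c = i div c mod b" "j mod (b' * c') div c' = j div c' mod b'"
    by (simp_all only: mult.commute)
  have modmod: "i mod (b * c) mod c = i mod c" "j mod (b' * c') mod c' = j mod c'"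
    by (simp_all add: mod_mod_cancel)
  have divdiv: "i div (b * c) = i div c div b" "j div (b' * c') = j div c' div b'"
    by (metis div_mult2_eq mult.commute)+
  have "i div c < a * b" "j div c' < a' * b'" using i j by (auto intro: less_mult_imp_div_less)
  then have "((A \<otimes>\<^sub>K B) \<otimes>\<^sub>K C) $$ (i, j) =
      A $$ (i div c div b, j div c' div b') * B $$ (i div c mod b, j div c' mod b') *
      C $$ (i mod c, j mod c')"
    using i(1) j(1) unfolding defs by (simp add: kronecker_index)
  moreover have "i mod (b * c) < b * c" "j mod (b' * c') < b' * c'"
    using i j by (auto intro: mod_less_of_less_mult)
  then have "(A \<otimes>\<^sub>K (B \<otimes>\<^sub>K C)) $$ (i, j) =
      A $$ (i div (b * c), j div (b' * c')) *
      (B $$ (i mod (b * c) div c, j mod (b' * c') div c') *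
       C $$ (i mod (b * c) mod c, j mod (b' * c') mod c'))"
    using i(2) j(2) unfolding defs by (simp add: kronecker_index)
  ultimately show ?case by (simp only: divmod modmod divdiv mult.assoc)
qed (simp_all add: mult.assoc)

lemma kronecker_one_one:
  "(1\<^sub>m a :: 'a :: semiring_1 mat) \<otimes>\<^sub>K 1\<^sub>m b = 1\<^sub>m (a * b)"
proof (rule eq_matI, goal_cases)
  case (1 i j)
  then have ij: "i < a * b" "j < a * b" by auto
  have "i = j \<longleftrightarrow> i div b = j div b \<and> i mod b = j mod b"
    by (metis div_mult_mod_eq)
  then show ?case
    using ij by (auto simp: kronecker_index less_mult_imp_div_less mod_less_of_less_mult)
qed auto

lemma kronecker_one_left: "(1\<^sub>m 1 :: 'a :: semiring_1 mat) \<otimes>\<^sub>K A = A"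
  by (rule eq_matI) (auto simp: kronecker_index)

lemma kronecker_one_index:
  assumes "B \<in> carrier_mat b c" and "i < a * b" and "j < a * c"
  shows "((1\<^sub>m a :: 'a :: semiring_1 mat) \<otimes>\<^sub>K B) $$ (i, j) =
    (if i div b = j div c then B $$ (i mod b, j mod c) else 0)"
  using assms by (auto simp: kronecker_index less_mult_imp_div_less)

lemma kronecker_one_mult:
  fixes A :: "'a :: comm_semiring_1 mat"
  assumes "A \<in> carrier_mat a b" and "B \<in> carrier_mat b c"
  shows "(1\<^sub>m m \<otimes>\<^sub>K A) * (1\<^sub>m m \<otimes>\<^sub>K B) = 1\<^sub>m m \<otimes>\<^sub>K (A * B)"
  using kronecker_mult[OF one_carrier_mat one_carrier_mat assms, of m] by simp

subsection \<open>Block rows and block columns\<close>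

lemma hcat_carrier:
  assumes "set As \<subseteq> carrier_mat nr nc"
  shows "hcat nr As \<in> carrier_mat nr (length As * nc)"
proof -
  have "length (concat (map cols As)) = length (map cols As) * nc"
    by (rule length_concat_uniform) (use assms in auto)
  then show ?thesis by (auto simp: hcat_def)
qed

lemma vcat_carrier:
  assumes "set As \<subseteq> carrier_mat nr nc"
  shows "vcat nc As \<in> carrier_mat (length As * nr) nc"
proof -
  have "length (concat (map rows As)) = length (map rows As) * nr"
    by (rule length_concat_uniform) (use assms in auto)
  then show ?thesis by (auto simp: vcat_def)
qed

lemma hcat_index:
  assumes "set As \<subseteq> carrier_mat nr nc" and "i < nr" and "j < length As * nc"
  shows "hcat nr As $$ (i, j) = (As ! (j div nc)) $$ (i, j mod nc)"
proof -
  have "concat (map cols As) ! j = map cols As ! (j div nc) ! (j mod nc)"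
    by (rule nth_concat_uniform) (use assms in auto)
  moreover have "length (concat (map cols As)) = length As * nc"
    by (subst length_concat_uniform[of _ nc]) (use assms in auto)
  moreover have "As ! (j div nc) \<in> carrier_mat nr nc"
    using nth_mem[OF less_mult_imp_div_less[OF assms(3)]] assms(1) by auto
  ultimately show ?thesis
    using assms(2,3) less_mult_imp_div_less[OF assms(3)] mod_less_of_less_mult[OF assms(3)]
    by (simp add: hcat_def mat_of_cols_def)
qed

lemma vcat_index:
  assumes "set As \<subseteq> carrier_mat nr nc" and "i < length As * nr" and "j < nc"
  shows "vcat nc As $$ (i, j) = (As ! (i div nr)) $$ (i mod nr, j)"
proof -
  have "concat (map rows As) ! i = map rows As ! (i div nr) ! (i mod nr)"
    by (rule nth_concat_uniform) (use assms in auto)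
  moreover have "length (concat (map rows As)) = length As * nr"
    by (subst length_concat_uniform[of _ nr]) (use assms in auto)
  moreover have "As ! (i div nr) \<in> carrier_mat nr nc"
    using nth_mem[OF less_mult_imp_div_less[OF assms(2)]] assms(1) by auto
  ultimately show ?thesis
    using assms(2,3) less_mult_imp_div_less[OF assms(2)] mod_less_of_less_mult[OF assms(2)]
    by (simp add: vcat_def mat_of_rows_def)
qed

lemma mult_hcat:
  fixes X :: "'a :: semiring_0 mat"
  assumes X: "X \<in> carrier_mat a b" and As: "set As \<subseteq> carrier_mat b c"
  shows "X * hcat b As = hcat a (map ((*) X) As)"
proof -
  have XAs: "set (map ((*) X) As) \<subseteq> carrier_mat a c"
    using X As by auto
  note cs = hcat_carrier[OF As] hcat_carrier[OF XAs]
  show ?thesis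
  proof (rule eq_matI, goal_cases)
    case (1 i j)
    then have ij: "i < a" "j < length As * c" using cs by auto
    have A: "As ! (j div c) \<in> carrier_mat b c"
      using nth_mem[OF less_mult_imp_div_less[OF ij(2)]] As by auto
    have "(X * hcat b As) $$ (i, j) = (\<Sum>k = 0..<b. X $$ (i, k) * hcat b As $$ (k, j))"
      by (rule mult_mat_index) (use ij cs X in auto)
    also have "\<dots> = (\<Sum>k = 0..<b. X $$ (i, k) * (As ! (j div c)) $$ (k, j mod c))"
      using ij by (intro sum.cong) (auto simp: hcat_index[OF As])
    also have "\<dots> = hcat a (map ((*) X) As) $$ (i, j)"
      using ij A X mod_less_of_less_mult[OF ij(2)] less_mult_imp_div_less[OF ij(2)]
      by (simp add: hcat_index[OF XAs] mult_mat_index[OF X A] del: index_mult_mat(1))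
    finally show ?case .
  qed (use X cs in auto)
qed

lemma vcat_mult:
  fixes X :: "'a :: semiring_0 mat"
  assumes X: "X \<in> carrier_mat b c" and As: "set As \<subseteq> carrier_mat a b"
  shows "vcat b As * X = vcat c (map (\<lambda>A. A * X) As)"
proof -
  have AXs: "set (map (\<lambda>A. A * X) As) \<subseteq> carrier_mat a c"
    using X As by auto
  note cs = vcat_carrier[OF As] vcat_carrier[OF AXs]
  show ?thesis
  proof (rule eq_matI, goal_cases)
    case (1 i j)
    then have ij: "i < length As * a" "j < c" using cs by auto
    have A: "As ! (i div a) \<in> carrier_mat a b"
      using nth_mem[OF less_mult_imp_div_less[OF ij(1)]] As by auto
    have "(vcat b As * X) $$ (i, j) = (\<Sum>k = 0..<b. vcat b As $$ (i, k) * X $$ (k, j))"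
      by (rule mult_mat_index) (use ij cs X in auto)
    also have "\<dots> = (\<Sum>k = 0..<b. (As ! (i div a)) $$ (i mod a, k) * X $$ (k, j))"
      using ij by (intro sum.cong) (auto simp: vcat_index[OF As])
    also have "\<dots> = vcat c (map (\<lambda>A. A * X) As) $$ (i, j)"
      using ij A X mod_less_of_less_mult[OF ij(1)] less_mult_imp_div_less[OF ij(1)]
      by (simp add: vcat_index[OF AXs] mult_mat_index[OF A X] del: index_mult_mat(1))
    finally show ?case .
  qed (use X cs in auto)
qed

text \<open>The Kronecker factor is block diagonal with copies of \<open>Y\<close>, so in the double
  sum over block and position the outer sum keeps only the block \<open>u = j div c\<close>.\<close>

lemma hcat_mult_kronecker:
  fixes Y :: "'a :: semiring_1 mat"
  assumes Y: "Y \<in> carrier_mat b c" and As: "set As \<subseteq> carrier_mat a b"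
  shows "hcat a As * (1\<^sub>m (length As) \<otimes>\<^sub>K Y) = hcat a (map (\<lambda>A. A * Y) As)"
proof -
  have AYs: "set (map (\<lambda>A. A * Y) As) \<subseteq> carrier_mat a c"
    using Y As by auto
  note cs = hcat_carrier[OF As] hcat_carrier[OF AYs]
  let ?m = "length As"
  show ?thesis
  proof (rule eq_matI, goal_cases)
    case (1 i j)
    then have ij: "i < a" "j < ?m * c" using cs by auto
    note j = less_mult_imp_div_less[OF ij(2)] mod_less_of_less_mult[OF ij(2)]
    have A: "As ! (j div c) \<in> carrier_mat a b"
      using nth_mem[OF less_mult_imp_div_less[OF ij(2)]] As by auto
    have "(hcat a As * (1\<^sub>m ?m \<otimes>\<^sub>K Y)) $$ (i, j) =
        (\<Sum>k = 0..<?m * b. hcat a As $$ (i, k) * (1\<^sub>m ?m \<otimes>\<^sub>K Y) $$ (k, j))"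
      by (rule mult_mat_index) (use ij cs Y in auto)
    also have "\<dots> = (\<Sum>k = 0..<?m * b. (\<lambda>u v. if u = j div c
        then (As ! u) $$ (i, v) * Y $$ (v, j mod c) else 0) (k div b) (k mod b))"
      using ij by (intro sum.cong)
        (auto simp: hcat_index[OF As] kronecker_one_index[OF Y])
    also have "\<dots> = (\<Sum>u = 0..<?m. \<Sum>v = 0..<b. if u = j div c
        then (As ! u) $$ (i, v) * Y $$ (v, j mod c) else 0)"
      by (rule sum_div_mod)
    also have "\<dots> = (\<Sum>u = 0..<?m. if u = j div c
        then \<Sum>v = 0..<b. (As ! u) $$ (i, v) * Y $$ (v, j mod c) else 0)"
      by (intro sum.cong) auto
    also have "\<dots> = (\<Sum>v = 0..<b. (As ! (j div c)) $$ (i, v) * Y $$ (v, j mod c))"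
      using j by simp
    also have "\<dots> = hcat a (map (\<lambda>A. A * Y) As) $$ (i, j)"
      using ij A Y j
      by (simp add: hcat_index[OF AYs] mult_mat_index[OF A Y] del: index_mult_mat(1))
    finally show ?case .
  qed (use Y cs in auto)
qed

text \<open>Dual of \<open>hcat_mult_kronecker\<close>: the block-diagonal factor acts from the left
  on a stack, and the outer sum keeps \<open>u = i div a\<close>.\<close>

lemma kronecker_mult_vcat:
  fixes X :: "'a :: semiring_1 mat"
  assumes X: "X \<in> carrier_mat a b" and As: "set As \<subseteq> carrier_mat b c"
  shows "(1\<^sub>m (length As) \<otimes>\<^sub>K X) * vcat c As = vcat c (map ((*) X) As)"
proof -
  have XAs: "set (map ((*) X) As) \<subseteq> carrier_mat a c"
    using X As by auto
  note cs = vcat_carrier[OF As] vcat_carrier[OF XAs]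
  let ?m = "length As"
  show ?thesis
  proof (rule eq_matI, goal_cases)
    case (1 i j)
    then have ij: "i < ?m * a" "j < c" using cs by auto
    note i = less_mult_imp_div_less[OF ij(1)] mod_less_of_less_mult[OF ij(1)]
    have A: "As ! (i div a) \<in> carrier_mat b c"
      using nth_mem[OF less_mult_imp_div_less[OF ij(1)]] As by auto
    have "((1\<^sub>m ?m \<otimes>\<^sub>K X) * vcat c As) $$ (i, j) =
        (\<Sum>k = 0..<?m * b. (1\<^sub>m ?m \<otimes>\<^sub>K X) $$ (i, k) * vcat c As $$ (k, j))"
      by (rule mult_mat_index) (use ij cs X in auto)
    also have "\<dots> = (\<Sum>k = 0..<?m * b. (\<lambda>u v. if u = i div a
        then X $$ (i mod a, v) * (As ! u) $$ (v, j) else 0) (k div b) (k mod b))"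
      using ij by (intro sum.cong)
        (auto simp: vcat_index[OF As] kronecker_one_index[OF X])
    also have "\<dots> = (\<Sum>u = 0..<?m. \<Sum>v = 0..<b. if u = i div a
        then X $$ (i mod a, v) * (As ! u) $$ (v, j) else 0)"
      by (rule sum_div_mod)
    also have "\<dots> = (\<Sum>u = 0..<?m. if u = i div a
        then \<Sum>v = 0..<b. X $$ (i mod a, v) * (As ! u) $$ (v, j) else 0)"
      by (intro sum.cong) auto
    also have "\<dots> = (\<Sum>v = 0..<b. X $$ (i mod a, v) * (As ! (i div a)) $$ (v, j))"
      using i by simp
    also have "\<dots> = vcat c (map ((*) X) As) $$ (i, j)"
      using ij A X i
      by (simp add: vcat_index[OF XAs] mult_mat_index[OF X A] del: index_mult_mat(1))
    finally show ?case .
  qed (use X cs in auto)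
qed

text \<open>As all blocks have \<open>a\<close> rows, row \<open>i\<close> of block \<open>u\<close>
  sits in row \<open>u * a + i\<close> of the stack. This splits an identity between stacked
  matrices into identities between blocks.\<close>

lemma vcat_inject:
  assumes As: "set As \<subseteq> carrier_mat a b"
    and Bs: "set Bs \<subseteq> carrier_mat a b"
    and len: "length As = length Bs" and eq: "vcat b As = vcat b Bs"
  shows "As = Bs"
proof (rule nth_equalityI[OF len])
  fix u assume u: "u < length As"
  have A: "As ! u \<in> carrier_mat a b" "Bs ! u \<in> carrier_mat a b"
    using u len nth_mem[of u] As Bs by auto
  show "As ! u = Bs ! u"
  proof (rule eq_matI, goal_cases)
    case (1 i j)
    then have ij: "i < a" "j < b" using A by auto
    have "u * a + i < Suc u * a" using ij by simp
    also have "\<dots> \<le> length As * a" using u by (intro mult_le_mono1) simp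
    finally have l: "u * a + i < length As * a" .
    have "(As ! u) $$ (i, j) = vcat b As $$ (u * a + i, j)"
      using ij l by (simp add: vcat_index[OF As])
    also have "\<dots> = (Bs ! u) $$ (i, j)"
      using ij l len by (simp add: eq vcat_index[OF Bs])
    finally show ?case .
  qed (use A in auto)
qed

subsection \<open>Adjoints\<close>

lemma mat_adjoint_dim [simp]:
  "dim_row (mat_adjoint A) = dim_col A" "dim_col (mat_adjoint A) = dim_row A"
  by (simp_all add: mat_adjoint_def)

lemma mat_adjoint_carrier [intro]:
  "A \<in> carrier_mat a b \<Longrightarrow> mat_adjoint A \<in> carrier_mat b a"
  by (metis carrier_matD carrier_matI mat_adjoint_dim)

lemma mat_adjoint_index:
  "i < dim_col A \<Longrightarrow> j < dim_row A \<Longrightarrow> mat_adjoint A $$ (i, j) = conjugate (A $$ (j, i))"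
  by (simp add: mat_adjoint_def mat_of_rows_def)

lemma mat_adjoint_adjoint [simp]: "mat_adjoint (mat_adjoint A) = A"
  by (rule eq_matI) (auto simp: mat_adjoint_index)

lemma mat_adjoint_mult:
  fixes A :: "complex mat"
  assumes A: "A \<in> carrier_mat a b" and B: "B \<in> carrier_mat b c"
  shows "mat_adjoint (A * B) = mat_adjoint B * mat_adjoint A"
proof (rule eq_matI, goal_cases)
  case (1 i j)
  then have ij: "i < c" "j < a" using A B by auto
  have "mat_adjoint (A * B) $$ (i, j) = (\<Sum>k = 0..<b. conjugate (A $$ (j, k) * B $$ (k, i)))"
    using A B ij by (simp add: mat_adjoint_index mult_mat_index[OF A B] del: index_mult_mat(1))
  also have "\<dots> = (\<Sum>k = 0..<b. mat_adjoint B $$ (i, k) * mat_adjoint A $$ (k, j))"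
    using A B ij by (intro sum.cong) (auto simp: mat_adjoint_index)
  also have "\<dots> = (mat_adjoint B * mat_adjoint A) $$ (i, j)"
    by (rule mult_mat_index[symmetric]) (use A B ij in auto)
  finally show ?case .
qed (use A B in auto)

lemma mat_adjoint_kronecker_one:
  "mat_adjoint (1\<^sub>m m \<otimes>\<^sub>K A) = 1\<^sub>m m \<otimes>\<^sub>K mat_adjoint (A :: complex mat)"
proof (rule eq_matI, goal_cases)
  case (1 i j)
  then have "j < m * dim_row A" "i < m * dim_col A" by auto
  then show ?case
    by (simp add: mat_adjoint_index kronecker_index less_mult_imp_div_less
        mod_less_of_less_mult)
qed auto

subsection \<open>Column spaces and inverses\<close>

text \<open>Each column of \<open>A\<close> is a column of the concatenation, hence a combination of
  columns of \<open>V\<close>; the coefficient vectors, chosen column by column, form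
  \<open>X\<close>. It serves for both projection bases.\<close>

lemma col_space_subset_factor:
  assumes V: "V \<in> carrier_mat n r"
    and sub: "column_space n (hcat n As) \<subseteq> column_space n V"
    and rows: "\<forall>A' \<in> set As. dim_row A' = n" and A: "A \<in> set As"
  obtains X where "X \<in> carrier_mat r (dim_col A)" and "A = V * X"
proof -
  interpret vec_space "TYPE(complex)" n .
  have cols: "set (concat (map cols As)) \<subseteq> carrier_vec n"
    using rows by (auto dest!: subsetD[OF cols_dim])
  have "\<exists>x \<in> carrier_vec r. V *\<^sub>v x = col A j" if "j < dim_col A" for j
  proof -
    have "col A j \<in> set (cols (hcat n As))"
    proof -
      have "col A j \<in> set (cols A)" using that by (simp add: cols_def)
      then show ?thesis using A unfolding hcat_def cols_mat_of_cols[OF cols] by auto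
    qed
    moreover have "set (cols (hcat n As)) \<subseteq> carrier_vec n"
      using cols by (simp add: hcat_def)
    ultimately have "col A j \<in> col_space (hcat n As)"
      unfolding col_space_def using span_mem by blast
    then have "col A j \<in> col_space V" using sub by blast
    then show ?thesis using col_space_eq[OF V] V by auto
  qed
  then obtain x where x: "\<And>j. j < dim_col A \<Longrightarrow> x j \<in> carrier_vec r \<and> V *\<^sub>v x j = col A j"
    by metis
  define X where "X = mat_of_cols r (map x [0..<dim_col A])"
  have X: "X \<in> carrier_mat r (dim_col A)"
    unfolding X_def by (rule carrier_matI) (simp_all add: mat_of_cols_def)
  moreover have "A = V * X"
  proof (rule mat_col_eqI)
    fix j assume "j < dim_col (V * X)"
    then have j: "j < dim_col A" using X by simp
    have "col (V * X) j = V *\<^sub>v col X j"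
      using V X j by (intro col_mult2) auto
    also have "col X j = x j"
      unfolding X_def using x j by (subst col_mat_of_cols) auto
    finally show "col A j = col (V * X) j" using x j by simp
  qed (use V X A rows in auto)
  ultimately show ?thesis using that by blast
qed

text \<open>Links the rank hypothesis with the option-valued inverse: full rank gives a nonzero
  determinant, hence a unit of the matrix ring, and \<open>mat_inverse\<close> returns
  \<open>None\<close> only for non-units.\<close>

lemma mat_inverse_full_rank:
  fixes A :: "'a :: field mat"
  assumes A: "A \<in> carrier_mat n n" and rank: "vec_space.rank n A = n"
  shows "mat_inverse A \<noteq> None"
proof
  assume "mat_inverse A = None"
  then have "A \<notin> Units (ring_mat TYPE('a) n ())" by (rule mat_inverse(1)[OF A])
  moreover have "det A \<noteq> 0" using vec_space.det_rank_iff[OF A] rank by simp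
  ultimately show False using det_non_zero_imp_unit[OF A, of "()"] by blast
qed

subsection \<open>Transfer functions as products of blocks\<close>

text \<open>\<open>N_row_at\<close> and \<open>N_col_at\<close> are two arrangements of this one
  list, so that passing from one to the other becomes an equality of lists.\<close>

definition N_list :: "bilinear_system \<Rightarrow> complex \<Rightarrow> complex mat list" where
  "N_list G s = map (\<lambda>j. the (N_fun G j s)) [1..<Suc (inputs G)]"

lemma length_N_list [simp]: "length (N_list G s) = inputs G"
  by (simp add: N_list_def)

lemma N_row_at_eq: "N_row_at G s = hcat (states G) (N_list G s)"
  and N_col_at_eq: "N_col_at G s = vcat (states G) (N_list G s)"
  by (simp_all add: N_row_at_def N_col_at_def N_list_def)

text \<open>A point in the domain of \<open>K_inv_fun\<close> is one where \<open>K_fun\<close> is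
  defined and \<open>mat_inverse\<close> succeeds; the specification of \<open>mat_inverse\<close>
  then provides both inverse laws.\<close>

lemma
  assumes S: "structured_bilinear_system G" and D: "defined_at G s"
  shows C_at_carrier: "C_at G s \<in> carrier_mat (outputs G) (states G)"
    and B_at_carrier: "B_at G s \<in> carrier_mat (states G) (inputs G)"
    and K_at_carrier: "K_at G s \<in> carrier_mat (states G) (states G)"
    and K_inv_at_carrier: "K_inv_at G s \<in> carrier_mat (states G) (states G)"
    and K_at_mult_K_inv_at: "K_at G s * K_inv_at G s = 1\<^sub>m (states G)"
    and K_inv_at_mult_K_at: "K_inv_at G s * K_at G s = 1\<^sub>m (states G)"
    and N_list_carrier: "set (N_list G s) \<subseteq> carrier_mat (states G) (states G)"
proof -
  obtain C B Ki where s: "C_fun G s = Some C" "B_fun G s = Some B" "K_inv_fun G s = Some Ki"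
    and N: "\<forall>j \<in> {1..inputs G}. s \<in> dom (N_fun G j)"
    using D by (auto simp: defined_at_def)
  obtain K where K: "K_fun G s = Some K" "mat_inverse K = Some Ki"
    using s(3) by (auto simp: K_inv_fun_def bind_eq_Some_conv)
  have c: "K \<in> carrier_mat (states G) (states G)"
    using S K(1) by (auto simp: structured_bilinear_system_def ran_def)
  show "C_at G s \<in> carrier_mat (outputs G) (states G)"
    "B_at G s \<in> carrier_mat (states G) (inputs G)"
    using S s by (auto simp: structured_bilinear_system_def C_at_def B_at_def ran_def)
  show "K_at G s \<in> carrier_mat (states G) (states G)"
    "K_inv_at G s \<in> carrier_mat (states G) (states G)"
    "K_at G s * K_inv_at G s = 1\<^sub>m (states G)"
    "K_inv_at G s * K_at G s = 1\<^sub>m (states G)"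
    using mat_inverse(2)[OF c K(2)] c by (simp_all add: K_at_def K_inv_at_def K s)
  show "set (N_list G s) \<subseteq> carrier_mat (states G) (states G)"
  proof
    fix A assume "A \<in> set (N_list G s)"
    then obtain j where j: "j \<in> {1..inputs G}" and A: "A = the (N_fun G j s)"
      by (auto simp: N_list_def less_Suc_eq_le simp del: upt_Suc)
    then have "N_fun G j s = Some A" using N by force
    then show "A \<in> carrier_mat (states G) (states G)"
      using S j ranI[of "N_fun G j" s A] by (auto simp: structured_bilinear_system_def)
  qed
qed

lemma
  assumes "structured_bilinear_system G" and "defined_at G s"
  shows N_row_at_carrier: "N_row_at G s \<in> carrier_mat (states G) (inputs G * states G)"
    and N_col_at_carrier: "N_col_at G s \<in> carrier_mat (inputs G * states G) (states G)"
  using hcat_carrier[OF N_list_carrier[OF assms]] vcat_carrier[OF N_list_carrier[OF assms]]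
  by (simp_all add: N_row_at_eq N_col_at_eq)

lemma V_block_carrier:
  assumes S: "structured_bilinear_system G"
    and "1 \<le> j" and "\<forall>i \<in> {1..j}. defined_at G (\<sigma> i)"
  shows "V_block G \<sigma> j \<in> carrier_mat (states G) (inputs G ^ j)"
  using assms(2,3)
proof (induction j rule: nat_induct_at_least)
  case base
  then show ?case
    using K_inv_at_carrier[OF S] B_at_carrier[OF S] by (auto intro!: mult_carrier_mat)
next
  case (Suc j)
  then obtain i where i: "j = Suc i" by (cases j) auto
  have "1\<^sub>m (inputs G) \<otimes>\<^sub>K V_block G \<sigma> j \<in>
      carrier_mat (inputs G * states G) (inputs G * inputs G ^ j)"
    using Suc by (intro kronecker_carrier) auto
  then show ?case
    using K_inv_at_carrier[OF S, of "\<sigma> (Suc j)"] N_row_at_carrier[OF S, of "\<sigma> j"] Suc.prems i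
    by (auto intro!: mult_carrier_mat)
qed

section \<open>From the Kronecker product formula to the recursion for the blocks\<close>

lemma mat_prod_0 [simp]: "mat_prod d A 0 = 1\<^sub>m d"
  and mat_prod_Suc [simp]: "mat_prod d A (Suc l) = mat_prod d A l * A (Suc l)"
  by (simp_all add: mat_prod_def)

lemma mat_prod_cong:
  assumes "\<And>j. j \<in> {1..l} \<Longrightarrow> A j = A' j"
  shows "mat_prod d A l = mat_prod d A' l"
  using assms by (induction l) auto

text \<open>The factor with index \<open>j\<close> in \<open>transfer\<close>, with the number
  \<open>k\<close> of points as an explicit parameter: the recursion compares the factors for
  \<open>Suc k\<close> with those for \<open>k\<close>.\<close>

definition transfer_factor ::
  "bilinear_system \<Rightarrow> (nat \<Rightarrow> complex) \<Rightarrow> nat \<Rightarrow> nat \<Rightarrow> complex mat" where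
  "transfer_factor G s k j =
     (1\<^sub>m (inputs G ^ (j - 1)) \<otimes>\<^sub>K N_row_at G (s (k - j))) *
     (1\<^sub>m (inputs G ^ j) \<otimes>\<^sub>K K_inv_at G (s (k - j)))"

text \<open>Since \<open>m ^ Suc l = m * m ^ l\<close>, the identity is itself a Kronecker product,
  and associativity splits one factor off on the left.\<close>

lemma kronecker_one_Suc:
  fixes A :: "'a :: semiring_1 mat"
  shows "1\<^sub>m (m ^ Suc l) \<otimes>\<^sub>K A = 1\<^sub>m m \<otimes>\<^sub>K (1\<^sub>m (m ^ l) \<otimes>\<^sub>K A)"
  by (simp add: kronecker_one_one[symmetric] kronecker_assoc)

context
  fixes G :: bilinear_system and s :: "nat \<Rightarrow> complex" and k :: nat
  assumes S: "structured_bilinear_system G" and D: "\<forall>i \<in> {1..k}. defined_at G (s i)"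
begin

lemma transfer_factor_carriers:
  assumes "Suc l < k"
  shows "1\<^sub>m (inputs G ^ l) \<otimes>\<^sub>K N_row_at G (s (k - Suc l)) \<in>
      carrier_mat (inputs G ^ l * states G) (inputs G ^ Suc l * states G)"
    and "1\<^sub>m (inputs G ^ Suc l) \<otimes>\<^sub>K K_inv_at G (s (k - Suc l)) \<in>
      carrier_mat (inputs G ^ Suc l * states G) (inputs G ^ Suc l * states G)"
proof -
  have d: "defined_at G (s (k - Suc l))" using assms by (intro bspec[OF D]) auto
  show "1\<^sub>m (inputs G ^ l) \<otimes>\<^sub>K N_row_at G (s (k - Suc l)) \<in>
      carrier_mat (inputs G ^ l * states G) (inputs G ^ Suc l * states G)"
    using kronecker_carrier[OF one_carrier_mat N_row_at_carrier[OF S d], of "inputs G ^ l"]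
    by (simp add: mult_ac)
  show "1\<^sub>m (inputs G ^ Suc l) \<otimes>\<^sub>K K_inv_at G (s (k - Suc l)) \<in>
      carrier_mat (inputs G ^ Suc l * states G) (inputs G ^ Suc l * states G)"
    by (rule kronecker_carrier[OF one_carrier_mat K_inv_at_carrier[OF S d]])
qed

lemma transfer_factor_carrier:
  assumes "Suc l < k"
  shows "transfer_factor G s k (Suc l) \<in>
    carrier_mat (inputs G ^ l * states G) (inputs G ^ Suc l * states G)"
  using mult_carrier_mat[OF transfer_factor_carriers[OF assms]]
  by (simp add: transfer_factor_def)

lemma mat_prod_transfer_factor_carrier:
  "l < k \<Longrightarrow> mat_prod (states G) (transfer_factor G s k) l \<in>
    carrier_mat (states G) (inputs G ^ l * states G)"
proof (induction l)
  case (Suc l)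
  show ?case
    unfolding mat_prod_Suc
    by (rule mult_carrier_mat[OF Suc.IH transfer_factor_carrier]) (use Suc.prems in auto)
qed simp

text \<open>Raising \<open>k\<close> and \<open>j\<close> together keeps the point
  \<open>s (k - j)\<close>; only the two identities grow by a factor \<open>m\<close>, which is
  pulled out in front.\<close>

lemma transfer_factor_Suc_Suc:
  assumes "Suc l < k"
  shows "transfer_factor G s (Suc k) (Suc (Suc l)) =
    1\<^sub>m (inputs G) \<otimes>\<^sub>K transfer_factor G s k (Suc l)"
  using kronecker_one_mult[OF transfer_factor_carriers[OF assms], of "inputs G"]
  by (simp only: transfer_factor_def kronecker_one_Suc diff_Suc_Suc diff_Suc_1)

text \<open>\<open>mat_prod_Suc\<close> adds factors at the right end, whereas
  \<open>V_block\<close> adds the newest point at the left end. By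
  \<open>transfer_factor_Suc_Suc\<close>, all factors after the first are those for \<open>k\<close>
  under a Kronecker product with the identity, so the mixed-product rule collects them behind the
  factor of \<open>s k\<close>.\<close>

lemma mat_prod_transfer_factor_Suc:
  "l < k \<Longrightarrow> mat_prod (states G) (transfer_factor G s (Suc k)) (Suc l) =
    N_row_at G (s k) *
    (1\<^sub>m (inputs G) \<otimes>\<^sub>K (K_inv_at G (s k) * mat_prod (states G) (transfer_factor G s k) l))"
proof (induction l)
  case 0
  then have d: "defined_at G (s k)" by (intro bspec[OF D]) auto
  have "transfer_factor G s (Suc k) (Suc 0) =
      N_row_at G (s k) * (1\<^sub>m (inputs G) \<otimes>\<^sub>K K_inv_at G (s k))"
    by (simp add: transfer_factor_def kronecker_one_left[simplified])
  moreover have "\<dots> \<in> carrier_mat (states G) (inputs G * states G)"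
    using N_row_at_carrier[OF S d] K_inv_at_carrier[OF S d]
    by (intro mult_carrier_mat kronecker_carrier) auto
  ultimately show ?case
    using K_inv_at_carrier[OF S d]
    by (simp add: left_mult_one_mat[where nc = "inputs G * states G"])
next
  case (Suc l)
  let ?n = "states G" and ?m = "inputs G"
  let ?M = "mat_prod ?n (transfer_factor G s k) l" and ?P = "transfer_factor G s k (Suc l)"
  have d: "defined_at G (s k)" using Suc.prems by (intro bspec[OF D]) auto
  note Ki = K_inv_at_carrier[OF S d]
  have M: "?M \<in> carrier_mat ?n (?m ^ l * ?n)"
    using Suc.prems by (intro mat_prod_transfer_factor_carrier) auto
  have P: "?P \<in> carrier_mat (?m ^ l * ?n) (?m ^ Suc l * ?n)"
    by (rule transfer_factor_carrier[OF Suc.prems])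
  note KM = mult_carrier_mat[OF Ki M]
  have "mat_prod ?n (transfer_factor G s (Suc k)) (Suc (Suc l)) =
      N_row_at G (s k) * (1\<^sub>m ?m \<otimes>\<^sub>K (K_inv_at G (s k) * ?M)) * (1\<^sub>m ?m \<otimes>\<^sub>K ?P)"
    using Suc by (simp only: mat_prod_Suc[of _ _ "Suc l"] transfer_factor_Suc_Suc)
  also have "\<dots> = N_row_at G (s k) *
      ((1\<^sub>m ?m \<otimes>\<^sub>K (K_inv_at G (s k) * ?M)) * (1\<^sub>m ?m \<otimes>\<^sub>K ?P))"
    by (rule assoc_mult_mat[OF N_row_at_carrier[OF S d]
          kronecker_carrier[OF one_carrier_mat KM] kronecker_carrier[OF one_carrier_mat P]])
  also have "\<dots> = N_row_at G (s k) * (1\<^sub>m ?m \<otimes>\<^sub>K (K_inv_at G (s k) * ?M * ?P))"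
    by (simp only: kronecker_one_mult[OF KM P])
  also have "K_inv_at G (s k) * ?M * ?P = K_inv_at G (s k) * (?M * ?P)"
    by (rule assoc_mult_mat[OF Ki M P])
  finally show ?case by simp
qed

end

text \<open>Induction along \<open>V_block\<close>: the identity factor distributes over the product
  from the induction hypothesis, and \<open>mat_prod_transfer_factor_Suc\<close> recognizes the
  longer product in the result.\<close>

lemma V_block_eq_mat_prod:
  assumes S: "structured_bilinear_system G"
  shows "\<forall>i \<in> {1..Suc k}. defined_at G (s i) \<Longrightarrow> V_block G s (Suc k) =
    K_inv_at G (s (Suc k)) * mat_prod (states G) (transfer_factor G s (Suc k)) k *
    (1\<^sub>m (inputs G ^ k) \<otimes>\<^sub>K B_at G (s 1))"
proof (induction k)
  case 0
  have "K_inv_at G (s 1) \<in> carrier_mat (states G) (states G)"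
    using 0 by (intro K_inv_at_carrier[OF S]) auto
  then show ?case by (simp add: kronecker_one_left[simplified])
next
  case (Suc k)
  let ?n = "states G" and ?m = "inputs G"
  let ?M = "mat_prod ?n (transfer_factor G s (Suc k)) k"
  let ?M' = "mat_prod ?n (transfer_factor G s (Suc (Suc k))) (Suc k)"
  let ?K = "K_inv_at G (s (Suc k))" and ?K' = "K_inv_at G (s (Suc (Suc k)))"
  let ?B = "1\<^sub>m (?m ^ k) \<otimes>\<^sub>K B_at G (s 1)"
  have K: "?K \<in> carrier_mat ?n ?n" "?K' \<in> carrier_mat ?n ?n"
    using Suc.prems by (auto intro!: K_inv_at_carrier[OF S])
  have N: "N_row_at G (s (Suc k)) \<in> carrier_mat ?n (?m * ?n)"
    using Suc.prems by (auto intro!: N_row_at_carrier[OF S])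
  have M: "?M \<in> carrier_mat ?n (?m ^ k * ?n)"
    using Suc.prems by (intro mat_prod_transfer_factor_carrier[OF S]) auto
  have B: "?B \<in> carrier_mat (?m ^ k * ?n) (?m ^ k * ?m)"
    using Suc.prems by (intro kronecker_carrier B_at_carrier[OF S]) auto
  note KM = mult_carrier_mat[OF K(1) M]
  note IKM = kronecker_carrier[OF one_carrier_mat[of ?m] KM]
  note IB = kronecker_carrier[OF one_carrier_mat[of ?m] B]
  have IH: "V_block G s (Suc k) = ?K * ?M * ?B"
    using Suc.prems by (intro Suc.IH) auto
  have M': "?M' = N_row_at G (s (Suc k)) * (1\<^sub>m ?m \<otimes>\<^sub>K (?K * ?M))"
    using Suc.prems by (intro mat_prod_transfer_factor_Suc[OF S]) auto
  have "V_block G s (Suc (Suc k)) = ?K' * N_row_at G (s (Suc k)) *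
      ((1\<^sub>m ?m \<otimes>\<^sub>K (?K * ?M)) * (1\<^sub>m ?m \<otimes>\<^sub>K ?B))"
    unfolding V_block.simps(2) IH kronecker_one_mult[OF KM B] ..
  also have "\<dots> = ?K' * N_row_at G (s (Suc k)) * (1\<^sub>m ?m \<otimes>\<^sub>K (?K * ?M)) * (1\<^sub>m ?m \<otimes>\<^sub>K ?B)"
    by (rule assoc_mult_mat[OF mult_carrier_mat[OF K(2) N] IKM IB, symmetric])
  also have "?K' * N_row_at G (s (Suc k)) * (1\<^sub>m ?m \<otimes>\<^sub>K (?K * ?M)) = ?K' * ?M'"
    unfolding M' by (rule assoc_mult_mat[OF K(2) N IKM])
  finally show ?case
    by (simp only: kronecker_one_Suc)
qed

text \<open>From here on \<open>transfer\<close> is accessed only through this identity, so that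
  interpolation becomes a statement about recursively defined blocks.\<close>

lemma transfer_eq_V_block:
  assumes S: "structured_bilinear_system G" and "1 \<le> k"
    and D: "\<forall>i \<in> {1..k}. defined_at G (s i)"
  shows "transfer G (map s [1..<k + 1]) = C_at G (s k) * V_block G s k"
proof -
  obtain l where k: "k = Suc l" using \<open>1 \<le> k\<close> by (cases k) auto
  let ?n = "states G" and ?m = "inputs G"
  let ?M = "mat_prod ?n (transfer_factor G s k) l"
  \<comment> \<open>List positions start at zero and points at one, hence the shift
    \<open>i - 1\<close>, as in \<open>transfer\<close>.\<close>
  have nth: "map s [1..<k + 1] ! (i - 1) = s i" if "i \<in> {1..k}" for i
    using that by (auto simp: nth_map simp del: upt_Suc)
  have M: "mat_prod ?n
       (\<lambda>j. (1\<^sub>m (?m ^ (j - 1)) \<otimes>\<^sub>K N_row_at G (map s [1..<k + 1] ! (k - j - 1))) *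
            (1\<^sub>m (?m ^ j) \<otimes>\<^sub>K K_inv_at G (map s [1..<k + 1] ! (k - j - 1)))) (k - 1) = ?M"
    unfolding k diff_Suc_1 transfer_factor_def
    by (rule mat_prod_cong) (use nth k in \<open>auto simp: Suc_diff_le simp del: upt_Suc\<close>)
  have d: "defined_at G (s k)" "defined_at G (s 1)" using D \<open>1 \<le> k\<close> by auto
  have "transfer G (map s [1..<k + 1]) =
      C_at G (s k) * K_inv_at G (s k) * ?M * (1\<^sub>m (?m ^ l) \<otimes>\<^sub>K B_at G (s 1))"
    using nth[of k] nth[of 1] M k by (simp add: transfer_def Let_def del: upt_Suc)
  moreover have "?M \<in> carrier_mat ?n (?m ^ l * ?n)"
    using D k by (intro mat_prod_transfer_factor_carrier[OF S]) auto
  moreover have "1\<^sub>m (?m ^ l) \<otimes>\<^sub>K B_at G (s 1) \<in> carrier_mat (?m ^ l * ?n) (?m ^ l * ?m)"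
    using B_at_carrier[OF S d(2)] by (intro kronecker_carrier) auto
  moreover note C_at_carrier[OF S d(1)] K_inv_at_carrier[OF S d(1)]
  moreover have "V_block G s k = K_inv_at G (s k) * ?M * (1\<^sub>m (?m ^ l) \<otimes>\<^sub>K B_at G (s 1))"
    unfolding k by (rule V_block_eq_mat_prod[OF S]) (use D k in auto)
  ultimately show ?thesis
    by (simp add: assoc_mult_mat[of _ "outputs G" ?n _ ?n _ "?m ^ l * ?n"]
        assoc_mult_mat[of _ "outputs G" ?n _ "?m ^ l * ?n" _ "?m ^ l * ?m"])
qed

subsection \<open>Pairing left and right blocks\<close>

text \<open>The right-hand side of the linear system with matrix \<open>K_at G (\<sigma> j)\<close>
  that \<open>V_block G \<sigma> j\<close> solves. For \<open>j \<ge> 2\<close> it involves only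
  points before \<open>\<sigma> j\<close>, so mixed interpolation can use it at position
  \<open>q + 1\<close> when only the first \<open>q\<close> blocks are under control.\<close>

fun R_block :: "bilinear_system \<Rightarrow> (nat \<Rightarrow> complex) \<Rightarrow> nat \<Rightarrow> complex mat" where
  "R_block G \<sigma> (Suc 0) = B_at G (\<sigma> 1)"
| "R_block G \<sigma> (Suc (Suc j)) =
     N_row_at G (\<sigma> (Suc j)) * (1\<^sub>m (inputs G) \<otimes>\<^sub>K V_block G \<sigma> (Suc j))"

abbreviation U_block :: "bilinear_system \<Rightarrow> nat \<Rightarrow> (nat \<Rightarrow> complex) \<Rightarrow> nat \<Rightarrow> complex mat" where
  "U_block G \<theta> \<tau> i \<equiv> mat_adjoint (W_block G \<theta> \<tau> i)"

lemma R_block_carrier: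
  assumes S: "structured_bilinear_system G" and "1 \<le> j"
    and D: "\<forall>i \<in> {1..j}. defined_at G (\<sigma> i)"
  shows "R_block G \<sigma> j \<in> carrier_mat (states G) (inputs G ^ j)"
proof (cases "j = 1")
  case True
  then show ?thesis using B_at_carrier[OF S bspec[OF D, of 1]] by auto
next
  case False
  then obtain i where j: "j = Suc (Suc i)"
    using \<open>1 \<le> j\<close> by (intro that[of "j - 2"]) linarith
  have "V_block G \<sigma> (Suc i) \<in> carrier_mat (states G) (inputs G ^ Suc i)"
    using j by (intro V_block_carrier[OF S] ballI bspec[OF D]) auto
  then have "1\<^sub>m (inputs G) \<otimes>\<^sub>K V_block G \<sigma> (Suc i) \<in>
      carrier_mat (inputs G * states G) (inputs G * inputs G ^ Suc i)"
    by (rule kronecker_carrier[OF one_carrier_mat])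
  moreover have "N_row_at G (\<sigma> (Suc i)) \<in> carrier_mat (states G) (inputs G * states G)"
    using j by (intro N_row_at_carrier[OF S] bspec[OF D]) auto
  ultimately show ?thesis by (simp add: j)
qed

lemma V_block_eq_R_block:
  assumes S: "structured_bilinear_system G" and "1 \<le> j"
    and D: "\<forall>i \<in> {1..j}. defined_at G (\<sigma> i)"
  shows "V_block G \<sigma> j = K_inv_at G (\<sigma> j) * R_block G \<sigma> j"
proof (cases "j = 1")
  case False
  then obtain i where j: "j = Suc (Suc i)"
    using \<open>1 \<le> j\<close> by (intro that[of "j - 2"]) linarith
  have "V_block G \<sigma> (Suc i) \<in> carrier_mat (states G) (inputs G ^ Suc i)"
    using j by (intro V_block_carrier[OF S] ballI bspec[OF D]) auto
  then have "1\<^sub>m (inputs G) \<otimes>\<^sub>K V_block G \<sigma> (Suc i) \<in>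
      carrier_mat (inputs G * states G) (inputs G * inputs G ^ Suc i)"
    by (rule kronecker_carrier[OF one_carrier_mat])
  moreover have "N_row_at G (\<sigma> (Suc i)) \<in> carrier_mat (states G) (inputs G * states G)"
    "K_inv_at G (\<sigma> j) \<in> carrier_mat (states G) (states G)"
    using j by (auto intro!: N_row_at_carrier[OF S] K_inv_at_carrier[OF S] bspec[OF D])
  ultimately show ?thesis
    unfolding j V_block.simps R_block.simps by (intro assoc_mult_mat)
qed simp

text \<open>Inverse-free form of the recursion: multiplied by \<open>mat_adjoint W\<close>, it
  becomes an equation of the reduced system.\<close>

lemma K_at_mult_V_block:
  assumes S: "structured_bilinear_system G" and j: "1 \<le> j"
    and D: "\<forall>i \<in> {1..j}. defined_at G (\<sigma> i)"
  shows "K_at G (\<sigma> j) * V_block G \<sigma> j = R_block G \<sigma> j"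
proof -
  have d: "defined_at G (\<sigma> j)" using D j by auto
  note R = R_block_carrier[OF S j D]
  have "K_at G (\<sigma> j) * V_block G \<sigma> j = K_at G (\<sigma> j) * K_inv_at G (\<sigma> j) * R_block G \<sigma> j"
    using assoc_mult_mat[OF K_at_carrier[OF S d] K_inv_at_carrier[OF S d] R]
    by (simp add: V_block_eq_R_block[OF S j D])
  then show ?thesis using R by (simp add: K_at_mult_K_inv_at[OF S d])
qed

lemma U_block_Suc_0:
  assumes S: "structured_bilinear_system G" and d: "defined_at G (\<tau> \<theta>)"
  shows "U_block G \<theta> \<tau> (Suc 0) = C_at G (\<tau> \<theta>) * K_inv_at G (\<tau> \<theta>)"
  using mat_adjoint_mult[OF mat_adjoint_carrier[OF K_inv_at_carrier[OF S d]]
      mat_adjoint_carrier[OF C_at_carrier[OF S d]]]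
  by simp

lemma W_block_carrier:
  assumes S: "structured_bilinear_system G"
    and "1 \<le> i" and "i \<le> \<theta>" and "\<forall>l \<in> {1..\<theta>}. defined_at G (\<tau> l)"
  shows "W_block G \<theta> \<tau> i \<in> carrier_mat (states G) (inputs G ^ (i - 1) * outputs G)"
  using assms(2-)
proof (induction i rule: nat_induct_at_least)
  case base
  then have "defined_at G (\<tau> \<theta>)" by auto
  then show ?case
    using mult_carrier_mat[OF mat_adjoint_carrier[OF K_inv_at_carrier[OF S]]
        mat_adjoint_carrier[OF C_at_carrier[OF S]]]
    by simp
next
  case (Suc i)
  then obtain i' where i: "i = Suc i'" by (cases i) auto
  have "1\<^sub>m (inputs G) \<otimes>\<^sub>K W_block G \<theta> \<tau> i \<in>
      carrier_mat (inputs G * states G) (inputs G * (inputs G ^ (i - 1) * outputs G))"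
    using Suc by (intro kronecker_carrier) auto
  moreover have d: "defined_at G (\<tau> (\<theta> - Suc i + 1))" using Suc.prems by auto
  ultimately show ?case
    using mat_adjoint_carrier[OF K_inv_at_carrier[OF S d]]
      mat_adjoint_carrier[OF N_col_at_carrier[OF S d]] i
    by (auto intro!: mult_carrier_mat simp: mult.assoc)
qed

lemma U_block_carrier:
  assumes "structured_bilinear_system G"
    and "1 \<le> i" and "i \<le> \<theta>" and "\<forall>l \<in> {1..\<theta>}. defined_at G (\<tau> l)"
  shows "U_block G \<theta> \<tau> i \<in> carrier_mat (inputs G ^ (i - 1) * outputs G) (states G)"
  using mat_adjoint_carrier[OF W_block_carrier[OF assms]] .

text \<open>The adjoint reverses the product and cancels the adjoints in \<open>W_block\<close>. The
  index \<open>\<theta> - Suc i + 1\<close> of the definition is \<open>\<theta> - i\<close> because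
  \<open>i < \<theta>\<close>.\<close>

lemma U_block_Suc:
  assumes S: "structured_bilinear_system G"
    and i: "1 \<le> i" "i < \<theta>" and D: "\<forall>l \<in> {1..\<theta>}. defined_at G (\<tau> l)"
  shows "U_block G \<theta> \<tau> (Suc i) =
    (1\<^sub>m (inputs G) \<otimes>\<^sub>K U_block G \<theta> \<tau> i) * N_col_at G (\<tau> (\<theta> - i)) * K_inv_at G (\<tau> (\<theta> - i))"
proof -
  obtain i' where i': "i = Suc i'" using i by (cases i) auto
  have d: "defined_at G (\<tau> (\<theta> - i))" using i by (intro bspec[OF D]) auto
  note Ki = K_inv_at_carrier[OF S d] and N = N_col_at_carrier[OF S d]
  have W: "W_block G \<theta> \<tau> i \<in> carrier_mat (states G) (inputs G ^ (i - 1) * outputs G)"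
    using i by (intro W_block_carrier[OF S _ _ D]) auto
  note IW = kronecker_carrier[OF one_carrier_mat[of "inputs G"] W]
  have idx: "\<theta> - Suc i + 1 = \<theta> - i" using i by simp
  have "U_block G \<theta> \<tau> (Suc i) = mat_adjoint (1\<^sub>m (inputs G) \<otimes>\<^sub>K W_block G \<theta> \<tau> i) *
      mat_adjoint (mat_adjoint (K_inv_at G (\<tau> (\<theta> - i))) * mat_adjoint (N_col_at G (\<tau> (\<theta> - i))))"
    using mat_adjoint_mult[OF mult_carrier_mat[OF mat_adjoint_carrier[OF Ki]
          mat_adjoint_carrier[OF N]] IW] idx
    by (simp add: i')
  also have "\<dots> = (1\<^sub>m (inputs G) \<otimes>\<^sub>K U_block G \<theta> \<tau> i) *
      (N_col_at G (\<tau> (\<theta> - i)) * K_inv_at G (\<tau> (\<theta> - i)))"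
    by (simp add: mat_adjoint_kronecker_one
        mat_adjoint_mult[OF mat_adjoint_carrier[OF Ki] mat_adjoint_carrier[OF N]])
  also have "\<dots> = (1\<^sub>m (inputs G) \<otimes>\<^sub>K U_block G \<theta> \<tau> i) * N_col_at G (\<tau> (\<theta> - i)) *
      K_inv_at G (\<tau> (\<theta> - i))"
    using assoc_mult_mat[OF kronecker_carrier[OF one_carrier_mat mat_adjoint_carrier[OF W]] N Ki]
    by simp
  finally show ?thesis .
qed

text \<open>Needed to pass between \<tau> and the joined sequence of mixed interpolation, which
  agree when counted from the end; the recursion never looks back further than \<open>i\<close>
  points.\<close>

lemma W_block_cong:
  assumes "1 \<le> i" and "i \<le> \<theta>" and "i \<le> \<theta>'" and "\<And>l. l < i \<Longrightarrow> \<tau> (\<theta> - l) = \<tau>' (\<theta>' - l)"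
  shows "W_block G \<theta> \<tau> i = W_block G \<theta>' \<tau>' i"
  using assms
proof (induction i rule: nat_induct_at_least)
  case base
  then show ?case using base(3)[of 0] by simp
next
  case (Suc i)
  then obtain i' where i: "i = Suc i'" by (cases i) auto
  have "\<tau> (\<theta> - Suc i') = \<tau>' (\<theta>' - Suc i')" using Suc.prems(3)[of i] i by simp
  moreover have "\<theta> - Suc i + 1 = \<theta> - Suc i'" "\<theta>' - Suc i + 1 = \<theta>' - Suc i'"
    using Suc.prems i by auto
  moreover have "W_block G \<theta> \<tau> i = W_block G \<theta>' \<tau>' i" using Suc by auto
  ultimately show ?case by (simp add: i)
qed

text \<open>The counterpart for right blocks: \<sigma> and the joined sequence agree when counted
  from the start.\<close>

lemma V_block_cong:
  assumes "1 \<le> j" and "\<And>i. i \<in> {1..j} \<Longrightarrow> \<sigma> i = \<sigma>' i"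
  shows "V_block G \<sigma> j = V_block G \<sigma>' j"
  using assms
proof (induction j rule: nat_induct_at_least)
  case (Suc j)
  then obtain i where i: "j = Suc i" by (cases j) auto
  have "\<sigma> (Suc j) = \<sigma>' (Suc j)" "\<sigma> j = \<sigma>' j" using Suc.prems Suc.hyps by auto
  moreover have "V_block G \<sigma> j = V_block G \<sigma>' j" using Suc by auto
  ultimately show ?case by (simp add: i)
qed simp

text \<open>The rows of \<open>(I \<otimes> U\<^sub>i) N K\<^sup>-\<^sup>1\<close>, with the \<open>N\<^sub>j\<close> stacked, and the columns of \<open>U\<^sub>i N (I \<otimes> V)\<close>,
  with the \<open>N\<^sub>j\<close> side by side, carry the same blocks \<open>U\<^sub>i N\<^sub>j V\<close>. An identity between the former
  therefore transfers to the latter.\<close>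

lemma stacked_to_row:
  assumes "structured_bilinear_system G" "defined_at G s"
    and "structured_bilinear_system H" "defined_at H s" and m: "inputs G = inputs H"
    and U: "U \<in> carrier_mat a (states G)" "U' \<in> carrier_mat a (states H)"
    and V: "V \<in> carrier_mat (states G) b" "V' \<in> carrier_mat (states H) b"
    and eq: "(1\<^sub>m (inputs G) \<otimes>\<^sub>K U) * N_col_at G s * V = (1\<^sub>m (inputs H) \<otimes>\<^sub>K U') * N_col_at H s * V'"
  shows "U * (N_row_at G s * (1\<^sub>m (inputs G) \<otimes>\<^sub>K V)) = U' * (N_row_at H s * (1\<^sub>m (inputs H) \<otimes>\<^sub>K V'))"
proof -
  define blocks where "blocks = (\<lambda>F U V. map (\<lambda>A. A * V) (map ((*) U) (N_list F s)))"
  \<comment> \<open>For an arbitrary system \<open>F\<close>, both arrangements are expressed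
    through the same list of blocks. This is then applied to both systems, whose state dimensions
    may differ.\<close>
  have main: "(1\<^sub>m (inputs F) \<otimes>\<^sub>K U) * N_col_at F s * V = vcat b (blocks F U V) \<and>
      U * (N_row_at F s * (1\<^sub>m (inputs F) \<otimes>\<^sub>K V)) = hcat a (blocks F U V) \<and>
      set (blocks F U V) \<subseteq> carrier_mat a b"
    if F: "structured_bilinear_system F" "defined_at F s"
      and U: "U \<in> carrier_mat a (states F)" and V: "V \<in> carrier_mat (states F) b"
    for F and U V :: "complex mat"
  proof -
    note N = N_list_carrier[OF F]
    have UN: "set (map ((*) U) (N_list F s)) \<subseteq> carrier_mat a (states F)"
      using N U by auto
    have "U * (N_row_at F s * (1\<^sub>m (inputs F) \<otimes>\<^sub>K V)) = U * N_row_at F s * (1\<^sub>m (inputs F) \<otimes>\<^sub>K V)"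
      by (rule assoc_mult_mat[OF U N_row_at_carrier[OF F]
            kronecker_carrier[OF one_carrier_mat V], symmetric])
    then show ?thesis
      using kronecker_mult_vcat[OF U N] vcat_mult[OF V UN] mult_hcat[OF U N]
        hcat_mult_kronecker[OF V UN] UN V
      by (auto simp: N_row_at_eq N_col_at_eq blocks_def)
  qed
  have "blocks G U V = blocks H U' V'"
    using main[of G U V] main[of H U' V'] assms
    by (intro vcat_inject[of _ a b]) (auto simp: blocks_def)
  then show ?thesis
    using main[of G U V] main[of H U' V'] assms by simp
qed

text \<open>Induction on \<open>i\<close> moves the split between left and right blocks to the last
  point, where the product is \<open>C_at * V_block\<close>. In the step, the inverse in
  \<open>U_block\<close> turns \<open>R_block\<close> into \<open>V_block\<close>, and
  \<open>stacked_to_row\<close> exchanges \<open>N_col_at\<close> for \<open>N_row_at\<close>, which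
  yields the product for the next split.\<close>

lemma transfer_eq_of_U_R:
  assumes S: "structured_bilinear_system G" "structured_bilinear_system H"
    and m: "inputs G = inputs H" and p: "outputs G = outputs H"
    and D: "\<forall>l \<in> {1..k}. defined_at G (s l)" "\<forall>l \<in> {1..k}. defined_at H (s l)"
    and "1 \<le> i" and "i \<le> k"
    and "U_block G k s i * R_block G s (k - i + 1) = U_block H k s i * R_block H s (k - i + 1)"
  shows "C_at G (s k) * V_block G s k = C_at H (s k) * V_block H s k"
  using assms(7-)
proof (induction i rule: nat_induct_at_least)
  case base
  have "U_block F k s 1 * R_block F s (k - 1 + 1) = C_at F (s k) * V_block F s k"
    if F: "structured_bilinear_system F" and D: "\<forall>l \<in> {1..k}. defined_at F (s l)" for F
  proof -
    have k: "1 \<le> k" "k - 1 + 1 = k" using base by auto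
    have d: "defined_at F (s k)" using D k by auto
    have "U_block F k s 1 * R_block F s k = C_at F (s k) * (K_inv_at F (s k) * R_block F s k)"
      using assoc_mult_mat[OF C_at_carrier[OF F d] K_inv_at_carrier[OF F d]
          R_block_carrier[OF F k(1) D]] U_block_Suc_0[of F s k, OF F d]
      by simp
    then show ?thesis using V_block_eq_R_block[OF F k(1) D] k by simp
  qed
  from this[OF S(1) D(1)] this[OF S(2) D(2)] base show ?case by simp
next
  case (Suc i)
  \<comment> \<open>The point \<open>s j\<close> is the one that passes from the left block to the
    right block.\<close>
  define j where "j = k - i"
  have j: "1 \<le> j" "j \<le> k" "k - Suc i + 1 = j" "k - i + 1 = Suc j" and i: "1 \<le> i" "i < k" "i \<le> k"
    using Suc.prems Suc.hyps by (auto simp: j_def)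
  obtain j' where j': "j = Suc j'" using j by (cases j) auto
  have U: "U_block F k s i \<in> carrier_mat (inputs F ^ (i - 1) * outputs F) (states F)"
    and V: "V_block F s j \<in> carrier_mat (states F) (inputs F ^ j)"
    and eq: "U_block F k s (Suc i) * R_block F s j =
      (1\<^sub>m (inputs F) \<otimes>\<^sub>K U_block F k s i) * N_col_at F (s j) * V_block F s j"
    and R: "R_block F s (Suc j) = N_row_at F (s j) * (1\<^sub>m (inputs F) \<otimes>\<^sub>K V_block F s j)"
    and d: "defined_at F (s j)"
    if F: "structured_bilinear_system F" and D: "\<forall>l \<in> {1..k}. defined_at F (s l)" for F
  proof -
    show d: "defined_at F (s j)" using D j by auto
    have Dj: "\<forall>l \<in> {1..j}. defined_at F (s l)" using D j by auto
    show U: "U_block F k s i \<in> carrier_mat (inputs F ^ (i - 1) * outputs F) (states F)"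
      by (rule U_block_carrier[OF F i(1,3) D])
    show "V_block F s j \<in> carrier_mat (states F) (inputs F ^ j)"
      by (rule V_block_carrier[OF F j(1) Dj])
    show "R_block F s (Suc j) = N_row_at F (s j) * (1\<^sub>m (inputs F) \<otimes>\<^sub>K V_block F s j)"
      by (simp add: j')
    have "U_block F k s (Suc i) = (1\<^sub>m (inputs F) \<otimes>\<^sub>K U_block F k s i) * N_col_at F (s j) *
        K_inv_at F (s j)"
      using U_block_Suc[OF F i(1,2) D] by (simp add: j_def)
    then show "U_block F k s (Suc i) * R_block F s j =
        (1\<^sub>m (inputs F) \<otimes>\<^sub>K U_block F k s i) * N_col_at F (s j) * V_block F s j"
      using assoc_mult_mat[OF mult_carrier_mat[OF kronecker_carrier[OF one_carrier_mat U]
            N_col_at_carrier[OF F d]] K_inv_at_carrier[OF F d] R_block_carrier[OF F j(1) Dj]]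
        V_block_eq_R_block[OF F j(1) Dj]
      by simp
  qed
  note G = S(1) D(1) and H = S(2) D(2)
  have "U_block G k s i * R_block G s (Suc j) = U_block H k s i * R_block H s (Suc j)"
    unfolding R[OF G] R[OF H]
  proof (rule stacked_to_row[OF S(1) d[OF G] S(2) d[OF H] m])
    show "(1\<^sub>m (inputs G) \<otimes>\<^sub>K U_block G k s i) * N_col_at G (s j) * V_block G s j =
        (1\<^sub>m (inputs H) \<otimes>\<^sub>K U_block H k s i) * N_col_at H (s j) * V_block H s j"
      using Suc.prems eq[OF G] eq[OF H] j by simp
  qed (use U[OF G] U[OF H] V[OF G] V[OF H] m p in auto)
  then show ?case using Suc.IH i j by simp
qed

subsection \<open>Projected systems\<close>

locale projection =
  fixes G :: bilinear_system and W V :: "complex mat" and r :: nat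
  assumes S: "structured_bilinear_system G"
    and W: "W \<in> carrier_mat (states G) r" and V: "V \<in> carrier_mat (states G) r"
begin

abbreviation "H \<equiv> reduced_system W V G"

lemma adjoint_W: "mat_adjoint W \<in> carrier_mat r (states G)"
  using W by (rule mat_adjoint_carrier)

lemma reduced_simps [simp]: "states H = r" "inputs H = inputs G" "outputs H = outputs G"
  using V by (auto simp: reduced_system_def)

lemma project_carrier:
  "A \<in> carrier_mat (states G) (states G) \<Longrightarrow> mat_adjoint W * A * V \<in> carrier_mat r r"
  using adjoint_W V by (intro mult_carrier_mat)

lemma structured_reduced: "structured_bilinear_system H"
proof -
  have "ran (C_fun H) \<subseteq> carrier_mat (outputs G) r"
  proof
    fix A' assume "A' \<in> ran (C_fun H)"
    then obtain s A where A: "C_fun G s = Some A" "A' = A * V"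
      by (auto simp: reduced_system_def ran_def)
    then have "A \<in> carrier_mat (outputs G) (states G)"
      using S ranI[of "C_fun G", OF A(1)]
      unfolding structured_bilinear_system_def by blast
    then show "A' \<in> carrier_mat (outputs G) r" unfolding A by (rule mult_carrier_mat[OF _ V])
  qed
  moreover have "ran (K_fun H) \<subseteq> carrier_mat r r"
  proof
    fix A' assume "A' \<in> ran (K_fun H)"
    then obtain s A where A: "K_fun G s = Some A" "A' = mat_adjoint W * A * V"
      by (auto simp: reduced_system_def ran_def)
    then have "A \<in> carrier_mat (states G) (states G)"
      using S ranI[of "K_fun G", OF A(1)]
      unfolding structured_bilinear_system_def by blast
    then show "A' \<in> carrier_mat r r" unfolding A by (rule project_carrier)
  qed
  moreover have "ran (B_fun H) \<subseteq> carrier_mat r (inputs G)"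
  proof
    fix A' assume "A' \<in> ran (B_fun H)"
    then obtain s A where A: "B_fun G s = Some A" "A' = mat_adjoint W * A"
      by (auto simp: reduced_system_def ran_def)
    then have "A \<in> carrier_mat (states G) (inputs G)"
      using S ranI[of "B_fun G", OF A(1)]
      unfolding structured_bilinear_system_def by blast
    then show "A' \<in> carrier_mat r (inputs G)" unfolding A by (rule mult_carrier_mat[OF adjoint_W])
  qed
  moreover have "ran (N_fun H j) \<subseteq> carrier_mat r r" if "j \<in> {1..inputs G}" for j
  proof
    fix A' assume "A' \<in> ran (N_fun H j)"
    then obtain s A where A: "N_fun G j s = Some A" "A' = mat_adjoint W * A * V"
      by (auto simp: reduced_system_def ran_def)
    then have "A \<in> carrier_mat (states G) (states G)"
      using S that ranI[of "N_fun G j", OF A(1)]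
      unfolding structured_bilinear_system_def by blast
    then show "A' \<in> carrier_mat r r" unfolding A by (rule project_carrier)
  qed
  ultimately show ?thesis by (simp add: structured_bilinear_system_def)
qed

lemma
  assumes d: "defined_at G s"
  shows C_at_reduced: "C_at H s = C_at G s * V"
    and B_at_reduced: "B_at H s = mat_adjoint W * B_at G s"
    and K_at_reduced: "K_at H s = mat_adjoint W * K_at G s * V"
    and N_list_reduced: "N_list H s = map (\<lambda>A. mat_adjoint W * A * V) (N_list G s)"
proof -
  obtain C B K where "C_fun G s = Some C" "B_fun G s = Some B" "K_fun G s = Some K"
    using d by (auto simp: defined_at_def K_inv_fun_def bind_eq_Some_conv)
  then show "C_at H s = C_at G s * V" "B_at H s = mat_adjoint W * B_at G s"
    "K_at H s = mat_adjoint W * K_at G s * V"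
    by (simp_all add: reduced_system_def C_at_def B_at_def K_at_def)
  have "the (N_fun H j s) = mat_adjoint W * the (N_fun G j s) * V" if "j \<in> {1..inputs G}" for j
    using d that by (force simp: defined_at_def reduced_system_def)
  then show "N_list H s = map (\<lambda>A. mat_adjoint W * A * V) (N_list G s)"
    by (simp add: N_list_def less_Suc_eq_le del: upt_Suc)
qed

text \<open>\<open>reduced_system\<close> keeps the domains of \<open>C_fun\<close>,
  \<open>K_fun\<close>, \<open>B_fun\<close> and \<open>N_fun\<close>, so only the invertibility of
  the projected \<open>K_at\<close> is at stake.\<close>

lemma defined_at_reduced:
  assumes d: "defined_at G s" and rank: "vec_space.rank r (K_at H s) = r"
  shows "defined_at H s"
proof -
  obtain K where K: "K_fun G s = Some K"
    using d by (auto simp: defined_at_def K_inv_fun_def bind_eq_Some_conv)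
  have "K_at H s \<in> carrier_mat r r"
    unfolding K_at_reduced[OF d] by (rule project_carrier[OF K_at_carrier[OF S d]])
  then have "mat_inverse (K_at H s) \<noteq> None" using rank by (rule mat_inverse_full_rank)
  then have "s \<in> dom (K_inv_fun H)"
    by (auto simp: K_inv_fun_def K_at_def reduced_system_def K)
  then show ?thesis
    using d by (auto simp: defined_at_def reduced_system_def dom_def)
qed

lemma N_row_at_reduced:
  assumes d: "defined_at G s"
  shows "N_row_at H s = mat_adjoint W * N_row_at G s * (1\<^sub>m (inputs G) \<otimes>\<^sub>K V)"
proof -
  note N = N_list_carrier[OF S d]
  have "set (map ((*) (mat_adjoint W)) (N_list G s)) \<subseteq> carrier_mat r (states G)"
    using N adjoint_W by auto
  from hcat_mult_kronecker[OF V this] mult_hcat[OF adjoint_W N]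
  show ?thesis by (simp add: N_row_at_eq N_list_reduced[OF d] comp_def)
qed

lemma N_col_at_reduced:
  assumes d: "defined_at G s"
  shows "N_col_at H s = (1\<^sub>m (inputs G) \<otimes>\<^sub>K mat_adjoint W) * N_col_at G s * V"
proof -
  note N = N_list_carrier[OF S d]
  have "set (map ((*) (mat_adjoint W)) (N_list G s)) \<subseteq> carrier_mat r (states G)"
    using N adjoint_W by auto
  from vcat_mult[OF V this] kronecker_mult_vcat[OF adjoint_W N]
  show ?thesis by (simp add: N_col_at_eq N_list_reduced[OF d] comp_def)
qed

text \<open>The factor \<open>V\<close> at the right of the reduced \<open>N_row_at\<close> meets
  the reduced block inside the Kronecker product and lifts it to the full one. The premise
  \<open>V_V\<close> speaks of the preceding block alone, so that the lemma fits both the induction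
  for \<open>V\<close> and the start \<open>j = 1\<close>, where there is none.\<close>

lemma R_block_reduced:
  assumes D: "\<forall>i \<in> {1..j}. defined_at G (\<sigma> i)" "\<forall>i \<in> {1..j}. defined_at H (\<sigma> i)"
    and "1 \<le> j" and V_V: "\<And>i. j = Suc i \<Longrightarrow> 1 \<le> i \<Longrightarrow> V * V_block H \<sigma> i = V_block G \<sigma> i"
  shows "R_block H \<sigma> j = mat_adjoint W * R_block G \<sigma> j"
proof (cases "j = 1")
  case True
  then show ?thesis using B_at_reduced[OF bspec[OF D(1), of 1]] True by simp
next
  case False
  then obtain i where j: "j = Suc (Suc i)"
    using \<open>1 \<le> j\<close> by (intro that[of "j - 2"]) linarith
  let ?m = "inputs G" and ?Vh = "V_block H \<sigma> (Suc i)"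
  have d: "defined_at G (\<sigma> (Suc i))" using j by (intro bspec[OF D(1)]) auto
  note N = N_row_at_carrier[OF S d] and IV = kronecker_carrier[OF one_carrier_mat[of ?m] V]
  have Vh: "?Vh \<in> carrier_mat r (?m ^ Suc i)"
    using V_block_carrier[OF structured_reduced, of "Suc i" \<sigma>] bspec[OF D(2)] j by simp
  note IVh = kronecker_carrier[OF one_carrier_mat[of ?m] Vh]
  have "R_block H \<sigma> j = mat_adjoint W * N_row_at G (\<sigma> (Suc i)) * (1\<^sub>m ?m \<otimes>\<^sub>K V) * (1\<^sub>m ?m \<otimes>\<^sub>K ?Vh)"
    by (simp add: j N_row_at_reduced[OF d])
  also have "\<dots> = mat_adjoint W * N_row_at G (\<sigma> (Suc i)) * ((1\<^sub>m ?m \<otimes>\<^sub>K V) * (1\<^sub>m ?m \<otimes>\<^sub>K ?Vh))"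
    by (rule assoc_mult_mat[OF mult_carrier_mat[OF adjoint_W N] IV IVh])
  also have "\<dots> = mat_adjoint W * (N_row_at G (\<sigma> (Suc i)) * ((1\<^sub>m ?m \<otimes>\<^sub>K V) * (1\<^sub>m ?m \<otimes>\<^sub>K ?Vh)))"
    by (rule assoc_mult_mat[OF adjoint_W N mult_carrier_mat[OF IV IVh]])
  also have "\<dots> = mat_adjoint W * R_block G \<sigma> j"
    using V_V[of "Suc i"] by (simp add: j kronecker_one_mult[OF V Vh])
  finally show ?thesis .
qed

text \<open>The Petrov-Galerkin argument: the full solution lies in the column space of
  \<open>V\<close>, so its coefficients \<open>X\<close> satisfy the projected equation, and the
  invertible matrix \<open>K_at H (\<sigma> j)\<close> leaves no other solution.\<close>

lemma V_mult_V_block_reduced: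
  assumes basis: "V_basis G k \<sigma> V"
    and D: "\<forall>i \<in> {1..k}. defined_at G (\<sigma> i)" "\<forall>i \<in> {1..k}. defined_at H (\<sigma> i)"
    and "1 \<le> j" and "j \<le> k"
  shows "V * V_block H \<sigma> j = V_block G \<sigma> j"
  using assms(4-)
proof (induction j rule: less_induct)
  case (less j)
  let ?n = "states G"
  have Dj: "\<forall>i \<in> {1..j}. defined_at G (\<sigma> i)" "\<forall>i \<in> {1..j}. defined_at H (\<sigma> i)"
    using less.prems D by auto
  have d: "defined_at G (\<sigma> j)" "defined_at H (\<sigma> j)" using Dj less.prems by auto
  note K = K_at_carrier[OF S d(1)]
  note Kh = K_at_carrier[OF structured_reduced d(2), simplified]
  note Kih = K_inv_at_carrier[OF structured_reduced d(2), simplified]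
  have "\<forall>A \<in> set (map (V_block G \<sigma>) [1..<Suc k]). dim_row A = ?n"
    using V_block_carrier[OF S] D(1) by (fastforce simp: less_Suc_eq_le simp del: upt_Suc)
  moreover have "V_block G \<sigma> j \<in> set (map (V_block G \<sigma>) [1..<Suc k])"
    using less.prems by (auto simp del: upt_Suc)
  ultimately obtain X where X: "X \<in> carrier_mat r (dim_col (V_block G \<sigma> j))"
    and VX: "V_block G \<sigma> j = V * X"
    using col_space_subset_factor[OF V basis[unfolded V_basis_def]] by blast
  have "K_at H (\<sigma> j) * X = mat_adjoint W * K_at G (\<sigma> j) * (V * X)"
    unfolding K_at_reduced[OF d(1)]
    by (rule assoc_mult_mat[OF mult_carrier_mat[OF adjoint_W K] V X])
  also have "\<dots> = mat_adjoint W * (K_at G (\<sigma> j) * (V * X))"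
    by (rule assoc_mult_mat[OF adjoint_W K mult_carrier_mat[OF V X]])
  also have "\<dots> = mat_adjoint W * R_block G \<sigma> j"
    using K_at_mult_V_block[OF S less.prems(1) Dj(1)] by (simp add: VX)
  also have "\<dots> = R_block H \<sigma> j"
    by (rule R_block_reduced[symmetric]) (use Dj less in auto)
  finally have KX: "K_at H (\<sigma> j) * X = R_block H \<sigma> j" .
  have "V_block H \<sigma> j = K_inv_at H (\<sigma> j) * (K_at H (\<sigma> j) * X)"
    unfolding KX by (rule V_block_eq_R_block[OF structured_reduced less.prems(1) Dj(2)])
  also have "\<dots> = K_inv_at H (\<sigma> j) * K_at H (\<sigma> j) * X"
    by (rule assoc_mult_mat[OF Kih Kh X, symmetric])
  also have "\<dots> = X"
    using X by (simp add: K_inv_at_mult_K_at[OF structured_reduced d(2)])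
  finally show ?case by (simp add: VX)
qed

text \<open>Dual of \<open>V_mult_V_block_reduced\<close>: factoring \<open>W_block\<close> through
  \<open>W\<close> gives a row matrix \<open>Y\<close>, which solves the reduced row equation and
  therefore is the reduced left block.\<close>

lemma U_block_reduced_mult_W:
  assumes basis: "W_basis G \<theta> \<tau> W"
    and D: "\<forall>l \<in> {1..\<theta>}. defined_at G (\<tau> l)" "\<forall>l \<in> {1..\<theta>}. defined_at H (\<tau> l)"
    and "1 \<le> i" and "i \<le> \<theta>"
  shows "U_block H \<theta> \<tau> i * mat_adjoint W = U_block G \<theta> \<tau> i"
  using assms(4-)
proof (induction i rule: nat_induct_at_least)
  \<comment> \<open>Common to base and induction step. \<open>P\<close> is \<open>C_at\<close> for
    the first block, and afterwards the preceding left block, under the Kronecker product, times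
    \<open>N_col_at\<close>; \<open>P * V\<close> is its reduced counterpart.\<close>
  have factor: "U_block H \<theta> \<tau> i * mat_adjoint W = U_block G \<theta> \<tau> i"
    if i: "1 \<le> i" "i \<le> \<theta>" and s: "s = \<tau> (\<theta> - i + 1)"
      and U: "U_block G \<theta> \<tau> i = P * K_inv_at G s" "U_block H \<theta> \<tau> i = P * V * K_inv_at H s"
      and P: "P \<in> carrier_mat (inputs G ^ (i - 1) * outputs G) (states G)"
    for i s P
  proof -
    have d: "defined_at G s" "defined_at H s" using D i by (auto simp: s)
    note K = K_at_carrier[OF S d(1)] and Ki = K_inv_at_carrier[OF S d(1)]
    note Kh = K_at_carrier[OF structured_reduced d(2), simplified]
    note Kih = K_inv_at_carrier[OF structured_reduced d(2), simplified]
    have Ui: "U_block G \<theta> \<tau> i \<in> carrier_mat (inputs G ^ (i - 1) * outputs G) (states G)"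
      by (rule U_block_carrier[OF S i D(1)])
    have "\<forall>A \<in> set (map (W_block G \<theta> \<tau>) [1..<Suc \<theta>]). dim_row A = states G"
      using carrier_matD(1)[OF W_block_carrier[OF S _ _ D(1)]]
      by (auto simp: less_Suc_eq_le simp del: upt_Suc)
    moreover have "W_block G \<theta> \<tau> i \<in> set (map (W_block G \<theta> \<tau>) [1..<Suc \<theta>])"
      using i by (auto simp del: upt_Suc)
    ultimately obtain X where X: "X \<in> carrier_mat r (dim_col (W_block G \<theta> \<tau> i))"
      and WX: "W_block G \<theta> \<tau> i = W * X"
      using col_space_subset_factor[OF W basis[unfolded W_basis_def]] by blast
    define Y where "Y = mat_adjoint X"
    have Y: "Y \<in> carrier_mat (dim_col (W_block G \<theta> \<tau> i)) r"
      using X by (auto simp: Y_def)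
    have UY: "U_block G \<theta> \<tau> i = Y * mat_adjoint W"
      unfolding WX Y_def by (rule mat_adjoint_mult[OF W X])
    \<comment> \<open>\<open>Y\<close> absorbs \<open>mat_adjoint W\<close> and becomes the full
      left block, whose inverse cancels against \<open>K_at G s\<close>; what remains is
      \<open>P * V\<close>.\<close>
    have "Y * K_at H s = Y * (mat_adjoint W * (K_at G s * V))"
      unfolding K_at_reduced[OF d(1)] by (simp only: assoc_mult_mat[OF adjoint_W K V])
    also have "\<dots> = U_block G \<theta> \<tau> i * (K_at G s * V)"
      unfolding UY by (rule assoc_mult_mat[OF Y adjoint_W mult_carrier_mat[OF K V], symmetric])
    also have "\<dots> = U_block G \<theta> \<tau> i * K_at G s * V"
      by (rule assoc_mult_mat[OF Ui K V, symmetric])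
    also have "U_block G \<theta> \<tau> i * K_at G s = P * (K_inv_at G s * K_at G s)"
      unfolding U by (rule assoc_mult_mat[OF P Ki K])
    also have "\<dots> = P" using P by (simp add: K_inv_at_mult_K_at[OF S d(1)])
    finally have "U_block H \<theta> \<tau> i = Y * K_at H s * K_inv_at H s" using U by simp
    also have "\<dots> = Y * (K_at H s * K_inv_at H s)"
      by (rule assoc_mult_mat[OF Y Kh Kih])
    also have "\<dots> = Y" using Y by (simp add: K_at_mult_K_inv_at[OF structured_reduced d(2)])
    finally show ?thesis by (simp add: UY)
  qed
  {
    case base
    then have d: "defined_at G (\<tau> \<theta>)" "defined_at H (\<tau> \<theta>)" using D by auto
    show ?case
      using base U_block_Suc_0[of G \<tau> \<theta>, OF S d(1)] C_at_carrier[OF S d(1)]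
        U_block_Suc_0[of H \<tau> \<theta>, OF structured_reduced d(2)] C_at_reduced[OF d(1)]
      by (intro factor[of 1 "\<tau> \<theta>" "C_at G (\<tau> \<theta>)"]) auto
  next
    case (Suc i)
    let ?m = "inputs G" and ?U = "U_block G \<theta> \<tau> i" and ?Uh = "U_block H \<theta> \<tau> i"
    let ?s = "\<tau> (\<theta> - i)"
    have i: "1 \<le> i" "i < \<theta>" "i \<le> \<theta>" using Suc by auto
    have IH: "?Uh * mat_adjoint W = ?U" using Suc by simp
    have d: "defined_at G ?s" using i by (intro bspec[OF D(1)]) auto
    note N = N_col_at_carrier[OF S d]
    have U: "?U \<in> carrier_mat (?m ^ (i - 1) * outputs G) (states G)"
      by (rule U_block_carrier[OF S i(1,3) D(1)])
    have Uh: "?Uh \<in> carrier_mat (?m ^ (i - 1) * outputs G) r"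
      using U_block_carrier[OF structured_reduced i(1,3) D(2)] by simp
    note IU = kronecker_carrier[OF one_carrier_mat[of ?m] U]
    note IUh = kronecker_carrier[OF one_carrier_mat[of ?m] Uh]
    note IW = kronecker_carrier[OF one_carrier_mat[of ?m] adjoint_W]
    have pow: "?m ^ i = ?m * ?m ^ (i - 1)" using i by (simp add: power_eq_if)
    \<comment> \<open>The factor \<open>mat_adjoint W\<close> of the reduced \<open>N_col_at\<close>
      lifts the reduced left block to the full one by the induction hypothesis.\<close>
    have "(1\<^sub>m ?m \<otimes>\<^sub>K ?Uh) * N_col_at H ?s =
        (1\<^sub>m ?m \<otimes>\<^sub>K ?Uh) * ((1\<^sub>m ?m \<otimes>\<^sub>K mat_adjoint W) * (N_col_at G ?s * V))"
      by (simp only: N_col_at_reduced[OF d] assoc_mult_mat[OF IW N V])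
    also have "\<dots> = (1\<^sub>m ?m \<otimes>\<^sub>K ?Uh) * (1\<^sub>m ?m \<otimes>\<^sub>K mat_adjoint W) * (N_col_at G ?s * V)"
      by (rule assoc_mult_mat[OF IUh IW mult_carrier_mat[OF N V], symmetric])
    also have "\<dots> = (1\<^sub>m ?m \<otimes>\<^sub>K ?U) * (N_col_at G ?s * V)"
      by (simp only: kronecker_one_mult[OF Uh adjoint_W] IH)
    also have "\<dots> = (1\<^sub>m ?m \<otimes>\<^sub>K ?U) * N_col_at G ?s * V"
      by (rule assoc_mult_mat[OF IU N V, symmetric])
    finally have "(1\<^sub>m ?m \<otimes>\<^sub>K ?Uh) * N_col_at H ?s = (1\<^sub>m ?m \<otimes>\<^sub>K ?U) * N_col_at G ?s * V" .
    then have "U_block H \<theta> \<tau> (Suc i) =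
        (1\<^sub>m ?m \<otimes>\<^sub>K ?U) * N_col_at G ?s * V * K_inv_at H ?s"
      using U_block_Suc[OF structured_reduced i(1,2) D(2)] by simp
    moreover have "(1\<^sub>m ?m \<otimes>\<^sub>K ?U) * N_col_at G ?s \<in>
        carrier_mat (?m ^ (Suc i - 1) * outputs G) (states G)"
      using mult_carrier_mat[OF IU N] pow by (simp add: mult.assoc)
    moreover have "?s = \<tau> (\<theta> - Suc i + 1)" using i by (simp add: Suc_diff_Suc)
    ultimately show ?case
      using U_block_Suc[OF S i(1,2) D(1)] i by (intro factor) auto
  }
qed

section \<open>Interpolation by one-sided and two-sided projection\<close>

lemma transfer_interpolation_V:
  assumes "V_basis G k \<sigma> V"
    and D: "\<forall>i \<in> {1..k}. defined_at G (\<sigma> i)" "\<forall>i \<in> {1..k}. defined_at H (\<sigma> i)"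
    and j: "1 \<le> j" "j \<le> k"
  shows "transfer G (map \<sigma> [1..<j + 1]) = transfer H (map \<sigma> [1..<j + 1])"
proof -
  have Dj: "\<forall>i \<in> {1..j}. defined_at G (\<sigma> i)" "\<forall>i \<in> {1..j}. defined_at H (\<sigma> i)"
    using j D by auto
  have d: "defined_at G (\<sigma> j)" using Dj j by auto
  have "V_block H \<sigma> j \<in> carrier_mat r (inputs G ^ j)"
    using V_block_carrier[OF structured_reduced j(1) Dj(2)] by simp
  then have "C_at H (\<sigma> j) * V_block H \<sigma> j = C_at G (\<sigma> j) * (V * V_block H \<sigma> j)"
    unfolding C_at_reduced[OF d] by (rule assoc_mult_mat[OF C_at_carrier[OF S d] V])
  then show ?thesis
    using V_mult_V_block_reduced[OF assms]
    unfolding transfer_eq_V_block[OF S j(1) Dj(1)]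
      transfer_eq_V_block[OF structured_reduced j(1) Dj(2)]
    by simp
qed

text \<open>The case \<open>q = 0\<close>, in which \<open>V\<close> is arbitrary, is part (b).\<close>

lemma transfer_interpolation_V_W:
  assumes V_basis: "q = 0 \<or> q \<le> k \<and> V_basis G k \<sigma> V" and W_basis: "W_basis G \<theta> \<tau> W"
    and D\<sigma>: "\<forall>i \<in> {1..k}. defined_at G (\<sigma> i)" "\<forall>i \<in> {1..k}. defined_at H (\<sigma> i)"
    and D\<tau>: "\<forall>l \<in> {1..\<theta>}. defined_at G (\<tau> l)" "\<forall>l \<in> {1..\<theta>}. defined_at H (\<tau> l)"
    and \<eta>: "1 \<le> \<eta>" "\<eta> \<le> \<theta>"
  shows "transfer G (map \<sigma> [1..<q + 1] @ map \<tau> [\<theta> - \<eta> + 1..<\<theta> + 1]) =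
    transfer H (map \<sigma> [1..<q + 1] @ map \<tau> [\<theta> - \<eta> + 1..<\<theta> + 1])"
proof -
  \<comment> \<open>The first \<open>q\<close> points come from \<sigma>, the other
    \<open>\<eta>\<close> are the last \<open>\<eta>\<close> points of \<tau>; position
    \<open>q + 1\<close> falls on \<open>\<tau> (\<theta> - \<eta> + 1)\<close>.\<close>
  define s where "s = (\<lambda>i. if i \<le> q then \<sigma> i else \<tau> (\<theta> - \<eta> + (i - q)))"
  define K where "K = q + \<eta>"
  have K: "1 \<le> K" "\<eta> \<le> K" "K - \<eta> + 1 = Suc q" "Suc q \<le> K" using \<eta> by (auto simp: K_def)
  have points: "map \<sigma> [1..<q + 1] @ map \<tau> [\<theta> - \<eta> + 1..<\<theta> + 1] = map s [1..<K + 1]"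
    using \<eta> by (intro nth_equalityI)
      (auto simp: K_def s_def nth_append simp del: upt_Suc intro!: arg_cong[of _ _ \<tau>])
  have D_s: "\<forall>i \<in> {1..K}. defined_at F (s i)"
    if "\<forall>i \<in> {1..k}. defined_at F (\<sigma> i)" "\<forall>l \<in> {1..\<theta>}. defined_at F (\<tau> l)" for F
  proof
    fix i assume i: "i \<in> {1..K}"
    show "defined_at F (s i)"
    proof (cases "i \<le> q")
      case True
      then show ?thesis using V_basis i that(1) by (auto simp: s_def)
    next
      case False
      then have "\<theta> - \<eta> + (i - q) \<in> {1..\<theta>}" using i \<eta> by (auto simp: K_def)
      then show ?thesis using False that(2) by (auto simp: s_def)
    qed
  qed
  note D = D_s[OF D\<sigma>(1) D\<tau>(1)] D_s[OF D\<sigma>(2) D\<tau>(2)]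
  have Dq: "\<forall>i \<in> {1..Suc q}. defined_at G (s i)" "\<forall>i \<in> {1..Suc q}. defined_at H (s i)"
    using K D by auto
  have V_V: "V * V_block H s q = V_block G s q" if "1 \<le> q"
  proof -
    have "V * V_block H \<sigma> q = V_block G \<sigma> q"
      using V_basis that by (intro V_mult_V_block_reduced[OF _ D\<sigma>]) auto
    moreover have "V_block F s q = V_block F \<sigma> q" for F
      by (rule V_block_cong[OF that]) (auto simp: s_def)
    ultimately show ?thesis by simp
  qed
  have R: "R_block H s (Suc q) = mat_adjoint W * R_block G s (Suc q)"
    by (rule R_block_reduced) (use Dq V_V in auto)
  have U_s: "U_block F K s \<eta> = U_block F \<theta> \<tau> \<eta>" for F
  proof -
    have "s (K - l) = \<tau> (\<theta> - l)" if "l < \<eta>" for l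
      using that \<eta> by (auto simp: s_def K_def intro!: arg_cong[of _ _ \<tau>])
    then show ?thesis using W_block_cong[of \<eta> K \<theta> s \<tau>] \<eta> K by auto
  qed
  have U: "U_block H K s \<eta> * mat_adjoint W = U_block G K s \<eta>"
    unfolding U_s by (rule U_block_reduced_mult_W[OF W_basis D\<tau> \<eta>])
  have Uh: "U_block H K s \<eta> \<in> carrier_mat (inputs G ^ (\<eta> - 1) * outputs G) r"
    using U_block_carrier[OF structured_reduced \<eta>(1) K(2) D(2)] by simp
  have "R_block G s (Suc q) \<in> carrier_mat (states G) (inputs G ^ Suc q)"
    by (rule R_block_carrier[OF S _ Dq(1)]) auto
  \<comment> \<open>\<open>mat_adjoint W\<close> is the joint between the two sides: it lifts the
    reduced left block to the full one, or projects the full right-hand side to the reduced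
    one.\<close>
  from assoc_mult_mat[OF Uh adjoint_W this]
  have "U_block G K s \<eta> * R_block G s (K - \<eta> + 1) = U_block H K s \<eta> * R_block H s (K - \<eta> + 1)"
    by (simp only: U R K)
  then have "C_at G (s K) * V_block G s K = C_at H (s K) * V_block H s K"
    using \<eta>(1) K(2) D by (intro transfer_eq_of_U_R[OF S structured_reduced]) auto
  then show ?thesis
    unfolding points transfer_eq_V_block[OF S K(1) D(1)]
      transfer_eq_V_block[OF structured_reduced K(1) D(2)] .
qed

end

theorem theorem8:
  fixes G :: bilinear_system and W V :: "complex mat" and r k \<theta> :: nat
    and \<sigma> \<tau> :: "nat \<Rightarrow> complex"
  assumes "structured_bilinear_system G"
    and "W \<in> carrier_mat (states G) r" and "V \<in> carrier_mat (states G) r"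
    and "\<And>s. s \<in> \<sigma> ` {1..k} \<union> \<tau> ` {1..\<theta>} \<Longrightarrow> defined_at G s"
    and "\<And>s. s \<in> \<sigma> ` {1..k} \<union> \<tau> ` {1..\<theta>} \<Longrightarrow>
           vec_space.rank r (K_at (reduced_system W V G) s) = r"
  shows
    "(V_basis G k \<sigma> V \<longrightarrow>
        (\<forall>j \<in> {1..k}.
           transfer G (map \<sigma> [1..<j + 1]) =
           transfer (reduced_system W V G) (map \<sigma> [1..<j + 1])))
   \<and> (W_basis G \<theta> \<tau> W \<longrightarrow>
        (\<forall>i \<in> {1..\<theta>}.
           transfer G (map \<tau> [\<theta> - i + 1..<\<theta> + 1]) =
           transfer (reduced_system W V G) (map \<tau> [\<theta> - i + 1..<\<theta> + 1])))
   \<and> (V_basis G k \<sigma> V \<and> W_basis G \<theta> \<tau> W \<longrightarrow>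
        (\<forall>q \<in> {1..k}. \<forall>\<eta> \<in> {1..\<theta>}.
           transfer G (map \<sigma> [1..<q + 1] @ map \<tau> [\<theta> - \<eta> + 1..<\<theta> + 1]) =
           transfer (reduced_system W V G)
             (map \<sigma> [1..<q + 1] @ map \<tau> [\<theta> - \<eta> + 1..<\<theta> + 1])))"
proof -
  interpret projection G W V r
    using assms by unfold_locales auto
  \<comment> \<open>The rank hypothesis enters here, making the points admissible for the reduced
    system.\<close>
  have D\<sigma>: "\<forall>i \<in> {1..k}. defined_at G (\<sigma> i)" "\<forall>i \<in> {1..k}. defined_at H (\<sigma> i)"
    using assms(4,5) by (auto intro: defined_at_reduced)
  have D\<tau>: "\<forall>l \<in> {1..\<theta>}. defined_at G (\<tau> l)" "\<forall>l \<in> {1..\<theta>}. defined_at H (\<tau> l)"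
    using assms(4,5) by (auto intro: defined_at_reduced)
  have "transfer G (map \<sigma> [1..<j + 1]) = transfer H (map \<sigma> [1..<j + 1])"
    if "V_basis G k \<sigma> V" and "j \<in> {1..k}" for j
    using that by (intro transfer_interpolation_V[OF _ D\<sigma>]) auto
  moreover have "transfer G (map \<tau> [\<theta> - i + 1..<\<theta> + 1]) = transfer H (map \<tau> [\<theta> - i + 1..<\<theta> + 1])"
    if "W_basis G \<theta> \<tau> W" and "i \<in> {1..\<theta>}" for i
    using that transfer_interpolation_V_W[of 0 k \<sigma> \<theta> \<tau> i, OF _ _ D\<sigma> D\<tau>]
    by (simp del: upt_Suc)
  moreover have "transfer G (map \<sigma> [1..<q + 1] @ map \<tau> [\<theta> - \<eta> + 1..<\<theta> + 1]) =
      transfer H (map \<sigma> [1..<q + 1] @ map \<tau> [\<theta> - \<eta> + 1..<\<theta> + 1])"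
    if "V_basis G k \<sigma> V \<and> W_basis G \<theta> \<tau> W" and "q \<in> {1..k}" and "\<eta> \<in> {1..\<theta>}" for q \<eta>
    using that by (intro transfer_interpolation_V_W[OF _ _ D\<sigma> D\<tau>]) auto
  ultimately show ?thesis by blast
qed

end
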